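(* Let $\Gamma$ be a finitely generated group and let $(\Gamma_n)$ be a Farber chain in $\Gamma$. Let $E$ denote the orbit relation of the action of $\Gamma$ on the boundary $\partial T$ of the coset tree $T=T(\Gamma,(\Gamma_n))$. Then $$\mathrm{RG}(\Gamma,(\Gamma_n))=\mathrm{cost}(E)-1 .$$
   Context: A chain in a finitely generated group $\Gamma$ is a sequence $\Gamma=\Gamma_0\ge\Gamma_1\ge\Gamma_2\ge\dots$ of subgroups of finite index. The coset tree $T=T(\Gamma,(\Gamma_n))$ is the rooted tree whose vertices of level $n$ are the right cosets $\Gamma_n g$ ($g\in\Gamma$), with an edge from $\Gamma_n g$ to $\Gamma_{n+1}g$ for all $n\ge 0$, $g\in\Gamma$; the root is $\Gamma_0=\Gamma$. Its boundary $\partial T$ is the set of infinite rays starting from the root. For a vertex $t=\Gamma_n g$ of level $n$, the shadow $\mathrm{Sh}(t)\subseteq\partial T$ is the set of rays passing through $t$; the shadows form a base of the topology of $\partial T$, and $\mu$ is the Borel probability measure on $\partial T$ with $\mu(\mathrm{Sh}(t))=1/|\Gamma:\Gamma_n|$. $\Gamma$ acts on $T$ by right multiplication on cosets, and hence on $\partial T$ by measure-preserving homeomorphisms. The chain is Farber if this action on $\partial T$ is essentially free, i.e. $\mu$-almost every point has trivial stabilizer in $\Gamma$. $d(G)$ is the minimal number of generators of a group $G$. The rank gradient is $\mathrm{RG}(\Gamma,(\Gamma_n))=\lim_{n\to\infty}\frac{d(\Gamma_n)-1}{|\Gamma:\Gamma_n|}$ (the sequence is non-increasing). Let a countable group $\Gamma$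 act on the right on a standard Borel space $X$ by Borel automorphisms preserving a probability measure $\mu$. The orbit relation is $E=\{(x,y)\in X\times X: y=x\cdot\gamma \text{ for some }\gamma\in\Gamma\}$. A Borel subgraph $S$ of $E$ is a directed graph on $X$ whose edge set is a Borel subset of $E$. It spans $E$ if any $(x,y)\in E$ with $x\neq y$ are joined by a finite path in $S$, where edges may be traversed in either direction. Its edge-measure is $e(S)=\int_X \deg_S(x)\,d\mu$ with $\deg_S(x)=|\{y\in X:(x,y)\in S\}|$. The cost is $\mathrm{cost}(E)=\mathrm{cost}(\Gamma,X)=\inf e(S)$ over all Borel subgraphs $S$ of $E$ that span $E$. *)

theory Defs
  imports "HOL-Analysis.Analysis" "HOL-Algebra.Generated_Groups"
begin

section \<open>Generators and rank gradient\<close>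

definition finitely_generated :: "('a, 'b) monoid_scheme \<Rightarrow> bool" where
  "finitely_generated G \<longleftrightarrow> (\<exists>S. finite S \<and> S \<subseteq> carrier G \<and> generate G S = carrier G)"

(* The value is meaningful only for finitely generated G; below it is applied to finite-index
   subgroups of a finitely generated group. *)
definition min_generators :: "('a, 'b) monoid_scheme \<Rightarrow> nat" where
  "min_generators G =
     (LEAST k. \<exists>S. finite S \<and> S \<subseteq> carrier G \<and> generate G S = carrier G \<and> card S = k)"

definition subgroup_index :: "('a, 'b) monoid_scheme \<Rightarrow> 'a set \<Rightarrow> nat" where
  "subgroup_index G H = card (rcosets\<^bsub>G\<^esub> H)"

locale finite_index_chain = group G for G (structure) +
  fixes \<Gamma> :: "nat \<Rightarrow> 'a set"
  assumes chain_0: "\<Gamma> 0 = carrier G"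
    and chain_subgroup: "subgroup (\<Gamma> n) G"
    and chain_Suc: "\<Gamma> (Suc n) \<subseteq> \<Gamma> n"
    and chain_finite_index: "finite (rcosets \<Gamma> n)"

definition rank_gradient :: "('a, 'b) monoid_scheme \<Rightarrow> (nat \<Rightarrow> 'a set) \<Rightarrow> real" where
  "rank_gradient G \<Gamma> =
     lim (\<lambda>n. (real (min_generators (G\<lparr>carrier := \<Gamma> n\<rparr>)) - 1) / real (subgroup_index G (\<Gamma> n)))"


section \<open>The coset tree and its boundary\<close>

(* A vertex is a coset tagged with its level: if two consecutive groups of the chain coincide, the
   same coset gives different vertices on the two levels. *)
definition coset_tree_vertices ::
    "('a, 'b) monoid_scheme \<Rightarrow> (nat \<Rightarrow> 'a set) \<Rightarrow> (nat \<times> 'a set) set" where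
  "coset_tree_vertices G \<Gamma> = (SIGMA n:UNIV. rcosets\<^bsub>G\<^esub> (\<Gamma> n))"

(* Edges are oriented away from the root, so that a ray from the root is a sequence of vertices
   along oriented edges. *)
definition coset_tree_edges ::
    "('a, 'b) monoid_scheme \<Rightarrow> (nat \<Rightarrow> 'a set) \<Rightarrow> ((nat \<times> 'a set) \<times> (nat \<times> 'a set)) set" where
  "coset_tree_edges G \<Gamma> =
     {((n, \<Gamma> n #>\<^bsub>G\<^esub> g), (Suc n, \<Gamma> (Suc n) #>\<^bsub>G\<^esub> g)) | n g. g \<in> carrier G}"

definition tree_boundary ::
    "('a, 'b) monoid_scheme \<Rightarrow> (nat \<Rightarrow> 'a set) \<Rightarrow> (nat \<Rightarrow> nat \<times> 'a set) set" where
  "tree_boundary G \<Gamma> =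
     {x. x 0 = (0, \<Gamma> 0) \<and> (\<forall>n. (x n, x (Suc n)) \<in> coset_tree_edges G \<Gamma>)}"

definition shadow ::
    "('a, 'b) monoid_scheme \<Rightarrow> (nat \<Rightarrow> 'a set) \<Rightarrow> nat \<times> 'a set \<Rightarrow> (nat \<Rightarrow> nat \<times> 'a set) set" where
  "shadow G \<Gamma> t = {x \<in> tree_boundary G \<Gamma>. t \<in> range x}"

definition boundary_topology ::
    "('a, 'b) monoid_scheme \<Rightarrow> (nat \<Rightarrow> 'a set) \<Rightarrow> (nat \<Rightarrow> nat \<times> 'a set) topology" where
  "boundary_topology G \<Gamma> = topology_generated_by (shadow G \<Gamma> ` coset_tree_vertices G \<Gamma>)"

definition is_boundary_measure ::
    "('a, 'b) monoid_scheme \<Rightarrow> (nat \<Rightarrow> 'a set) \<Rightarrow> (nat \<Rightarrow> nat \<times> 'a set) measure \<Rightarrow> bool" where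
  "is_boundary_measure G \<Gamma> M \<longleftrightarrow>
     space M = tree_boundary G \<Gamma> \<and>
     sets M = sigma_sets (tree_boundary G \<Gamma>) {U. openin (boundary_topology G \<Gamma>) U} \<and>
     emeasure M (space M) = 1 \<and>
     (\<forall>(n, C) \<in> coset_tree_vertices G \<Gamma>.
        emeasure M (shadow G \<Gamma> (n, C)) = ennreal (1 / real (subgroup_index G (\<Gamma> n))))"

(* Existence and uniqueness are proved at the end of this theory. *)
definition boundary_measure ::
    "('a, 'b) monoid_scheme \<Rightarrow> (nat \<Rightarrow> 'a set) \<Rightarrow> (nat \<Rightarrow> nat \<times> 'a set) measure" where
  "boundary_measure G \<Gamma> = (THE M. is_boundary_measure G \<Gamma> M)"

definition boundary_action ::
    "('a, 'b) monoid_scheme \<Rightarrow> (nat \<Rightarrow> nat \<times> 'a set) \<Rightarrow> 'a \<Rightarrow> (nat \<Rightarrow> nat \<times> 'a set)" where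
  "boundary_action G x \<gamma> = (\<lambda>n. (fst (x n), snd (x n) #>\<^bsub>G\<^esub> \<gamma>))"


section \<open>Right actions, orbit relations and cost\<close>

definition point_stabilizer :: "('a, 'b) monoid_scheme \<Rightarrow> ('x \<Rightarrow> 'a \<Rightarrow> 'x) \<Rightarrow> 'x \<Rightarrow> 'a set" where
  "point_stabilizer G act x = {\<gamma> \<in> carrier G. act x \<gamma> = x}"

definition essentially_free :: "('a, 'b) monoid_scheme \<Rightarrow> 'x measure \<Rightarrow> ('x \<Rightarrow> 'a \<Rightarrow> 'x) \<Rightarrow> bool" where
  "essentially_free G M act \<longleftrightarrow> (AE x in M. point_stabilizer G act x = {\<one>\<^bsub>G\<^esub>})"

definition orbit_relation :: "('a, 'b) monoid_scheme \<Rightarrow> 'x set \<Rightarrow> ('x \<Rightarrow> 'a \<Rightarrow> 'x) \<Rightarrow> ('x \<times> 'x) set" where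
  "orbit_relation G X act = {(x, y) \<in> X \<times> X. \<exists>\<gamma> \<in> carrier G. y = act x \<gamma>}"

definition borel_subgraph :: "'x measure \<Rightarrow> ('x \<times> 'x) set \<Rightarrow> ('x \<times> 'x) set \<Rightarrow> bool" where
  "borel_subgraph M E S \<longleftrightarrow> S \<in> sets (M \<Otimes>\<^sub>M M) \<and> S \<subseteq> E"

definition graph_spans :: "('x \<times> 'x) set \<Rightarrow> ('x \<times> 'x) set \<Rightarrow> bool" where
  "graph_spans S E \<longleftrightarrow> (\<forall>(x, y) \<in> E. x \<noteq> y \<longrightarrow> (x, y) \<in> (S \<union> S\<inverse>)\<^sup>*)"

(* Infinite degrees have value infinity; this is why card is not used. *)
definition out_degree :: "('x \<times> 'x) set \<Rightarrow> 'x \<Rightarrow> ennreal" where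
  "out_degree S x = emeasure (count_space UNIV) {y. (x, y) \<in> S}"

definition edge_measure :: "'x measure \<Rightarrow> ('x \<times> 'x) set \<Rightarrow> ennreal" where
  "edge_measure M S = (\<integral>\<^sup>+ x. out_degree S x \<partial>M)"

definition cost :: "'x measure \<Rightarrow> ('x \<times> 'x) set \<Rightarrow> ennreal" where
  "cost M E = (INF S \<in> {S. borel_subgraph M E S \<and> graph_spans S E}. edge_measure M S)"

definition farber_chain :: "('a, 'b) monoid_scheme \<Rightarrow> (nat \<Rightarrow> 'a set) \<Rightarrow> bool" where
  "farber_chain G \<Gamma> \<longleftrightarrow>
     finite_index_chain G \<Gamma> \<and> essentially_free G (boundary_measure G \<Gamma>) (boundary_action G)"

definition boundary_orbit_relation :: "('a, 'b) monoid_scheme \<Rightarrow> (nat \<Rightarrow> 'a set) \<Rightarrow>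
    ((nat \<Rightarrow> nat \<times> 'a set) \<times> (nat \<Rightarrow> nat \<times> 'a set)) set" where
  "boundary_orbit_relation G \<Gamma> = orbit_relation G (tree_boundary G \<Gamma>) (boundary_action G)"

section \<open>Existence and uniqueness of the boundary measure\<close>

context finite_index_chain
begin

lemma chain_subset: "\<Gamma> n \<subseteq> carrier G"
  using chain_subgroup subgroup.subset by blast

lemma chain_antimono: "m \<le> n \<Longrightarrow> \<Gamma> n \<subseteq> \<Gamma> m"
  using lift_Suc_antimono_le[of \<Gamma> m n] chain_Suc by blast

lemma rcosetD:
  assumes "C \<in> rcosets \<Gamma> n" "g \<in> C"
  shows "g \<in> carrier G" "C = \<Gamma> n #> g"
proof -
  obtain a where a: "a \<in> carrier G" "C = \<Gamma> n #> a"
    using assms by (auto simp: RCOSETS_def)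
  show "C = \<Gamma> n #> g"
    using repr_independence[OF _ a(1) chain_subgroup] assms a by blast
  show "g \<in> carrier G"
    using a assms chain_subset by (auto simp: r_coset_def)
qed

lemma rcoset_nonempty: "C \<in> rcosets \<Gamma> n \<Longrightarrow> \<exists>g \<in> carrier G. g \<in> C \<and> C = \<Gamma> n #> g"
  using rcos_self[OF _ chain_subgroup] by (auto simp: RCOSETS_def)

lemma rcoset_mono: "m \<le> n \<Longrightarrow> \<Gamma> n #> g \<subseteq> \<Gamma> m #> g"
  using chain_antimono by (auto simp: r_coset_def)

lemma edge_iff:
  "((n, C), (m, D)) \<in> coset_tree_edges G \<Gamma> \<longleftrightarrow>
     m = Suc n \<and> C \<in> rcosets \<Gamma> n \<and> D \<in> rcosets \<Gamma> (Suc n) \<and> D \<subseteq> C"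
proof (intro iffI; (elim conjE)?)
  assume "((n, C), (m, D)) \<in> coset_tree_edges G \<Gamma>"
  then obtain g where "g \<in> carrier G" "C = \<Gamma> n #> g" "D = \<Gamma> (Suc n) #> g" "m = Suc n"
    by (auto simp: coset_tree_edges_def)
  then show "m = Suc n \<and> C \<in> rcosets \<Gamma> n \<and> D \<in> rcosets \<Gamma> (Suc n) \<and> D \<subseteq> C"
    using rcosetsI[OF chain_subset] rcoset_mono[of n "Suc n"] by auto
next
  assume *: "m = Suc n" "C \<in> rcosets \<Gamma> n" "D \<in> rcosets \<Gamma> (Suc n)" "D \<subseteq> C"
  then obtain g where g: "g \<in> carrier G" "g \<in> D" "D = \<Gamma> (Suc n) #> g"
    using rcoset_nonempty by blast
  then have "C = \<Gamma> n #> g"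
    using * rcosetD by blast
  then show "((n, C), (m, D)) \<in> coset_tree_edges G \<Gamma>"
    using * g by (auto simp: coset_tree_edges_def)
qed

lemma boundary_iff:
  "x \<in> tree_boundary G \<Gamma> \<longleftrightarrow>
     (\<forall>n. fst (x n) = n \<and> snd (x n) \<in> rcosets \<Gamma> n \<and> snd (x (Suc n)) \<subseteq> snd (x n))"
  (is "_ \<longleftrightarrow> ?R")
proof
  assume x: "x \<in> tree_boundary G \<Gamma>"
  have fst: "fst (x n) = n" for n
  proof (induction n)
    case 0
    then show ?case using x by (simp add: tree_boundary_def)
  next
    case (Suc n)
    have "(x n, x (Suc n)) \<in> coset_tree_edges G \<Gamma>"
      using x by (simp add: tree_boundary_def)
    then show ?case using Suc by (auto simp: coset_tree_edges_def)
  qed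
  have "((n, snd (x n)), (Suc n, snd (x (Suc n)))) \<in> coset_tree_edges G \<Gamma>" for n
    using x fst[of n] fst[of "Suc n"] by (metis (no_types, lifting) tree_boundary_def mem_Collect_eq prod.collapse)
  then show ?R using fst by (auto simp: edge_iff)
next
  assume R: ?R
  then have "x n = (n, snd (x n))" for n
    by (metis prod.collapse)
  then have e: "(x n, x (Suc n)) \<in> coset_tree_edges G \<Gamma>" for n
    using R edge_iff by metis
  have "snd (x 0) \<in> rcosets \<Gamma> 0" using R by blast
  then obtain g where "g \<in> carrier G" "snd (x 0) = \<Gamma> 0 #> g"
    using rcoset_nonempty by blast
  then have "snd (x 0) = \<Gamma> 0"
    using coset_join2[of g "\<Gamma> 0"] chain_subgroup chain_0 by metis
  then have "x 0 = (0, \<Gamma> 0)" using R by (metis prod.collapse)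
  then show "x \<in> tree_boundary G \<Gamma>"
    using e by (simp add: tree_boundary_def)
qed

lemma boundary_fst: "x \<in> tree_boundary G \<Gamma> \<Longrightarrow> fst (x n) = n"
  and boundary_snd: "x \<in> tree_boundary G \<Gamma> \<Longrightarrow> snd (x n) \<in> rcosets \<Gamma> n"
  by (simp_all add: boundary_iff)

lemma boundary_subset:
  assumes "x \<in> tree_boundary G \<Gamma>" "m \<le> n"
  shows "snd (x n) \<subseteq> snd (x m)"
  using lift_Suc_antimono_le[of "\<lambda>n. snd (x n)" m n] assms by (simp add: boundary_iff)

lemma parent_unique:
  assumes "C \<in> rcosets \<Gamma> n" "C' \<in> rcosets \<Gamma> n" "D \<in> rcosets \<Gamma> m" "D \<subseteq> C" "D \<subseteq> C'"
  shows "C = C'"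
proof -
  obtain g where "g \<in> D" using assms rcoset_nonempty by blast
  then show ?thesis using assms rcosetD(2)[of C n g] rcosetD(2)[of C' n g] by auto
qed

lemma boundary_agree:
  assumes "x \<in> tree_boundary G \<Gamma>" "y \<in> tree_boundary G \<Gamma>" "x n = y n" "m \<le> n"
  shows "x m = y m"
proof -
  have "snd (x m) = snd (y m)"
    using parent_unique[of "snd (x m)" m "snd (y m)" "snd (x n)" n] assms
      boundary_snd boundary_subset by metis
  then show ?thesis
    using boundary_fst assms(1,2) by (metis prod_eqI)
qed

lemma shadow_iff: "x \<in> shadow G \<Gamma> (n, C) \<longleftrightarrow> x \<in> tree_boundary G \<Gamma> \<and> x n = (n, C)"
proof -
  have "x k = (n, C) \<Longrightarrow> x \<in> tree_boundary G \<Gamma> \<Longrightarrow> x n = (n, C)" for k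
    using boundary_fst[of x k] by auto
  then show ?thesis
    by (auto simp: shadow_def) (metis rangeI)
qed

definition canonical_ray :: "'a \<Rightarrow> nat \<Rightarrow> nat \<times> 'a set" where
  "canonical_ray g = (\<lambda>n. (n, \<Gamma> n #> g))"

lemma canonical_ray: "g \<in> carrier G \<Longrightarrow> canonical_ray g \<in> tree_boundary G \<Gamma>"
  using rcosetsI[OF chain_subset] rcoset_mono[of _ "Suc _"] by (auto simp: boundary_iff canonical_ray_def)

lemma level_image: "(\<lambda>x. snd (x n)) ` tree_boundary G \<Gamma> = rcosets \<Gamma> n"
proof
  show "(\<lambda>x. snd (x n)) ` tree_boundary G \<Gamma> \<subseteq> rcosets \<Gamma> n"
    using boundary_snd by blast
  show "rcosets \<Gamma> n \<subseteq> (\<lambda>x. snd (x n)) ` tree_boundary G \<Gamma>"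
  proof
    fix C assume "C \<in> rcosets \<Gamma> n"
    then obtain g where "g \<in> carrier G" "C = \<Gamma> n #> g"
      using rcoset_nonempty by blast
    then show "C \<in> (\<lambda>x. snd (x n)) ` tree_boundary G \<Gamma>"
      using canonical_ray[of g] by (auto simp: canonical_ray_def image_iff intro!: bexI[of _ "canonical_ray g"])
  qed
qed

definition idx :: "nat \<Rightarrow> nat" where "idx n = card (rcosets \<Gamma> n)"

lemma idx_pos: "idx n > 0"
  unfolding idx_def using chain_finite_index rcosetsI[OF chain_subset one_closed]
  by (metis card_gt_0_iff empty_iff)

definition fibre :: "nat \<Rightarrow> 'a set \<Rightarrow> 'a set set" where
  "fibre m C = {D \<in> rcosets \<Gamma> m. D \<subseteq> C}"

lemma fibre_translate:
  assumes "C \<in> rcosets \<Gamma> n" "g \<in> carrier G"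
  shows "card (fibre m C) \<le> card (fibre m (C #> g))"
proof (rule card_inj_on_le)
  have sub: "D \<subseteq> carrier G" if "D \<in> rcosets \<Gamma> k" for D k
    using that rcosets_subset_PowG[OF chain_subgroup] by blast
  show "inj_on (\<lambda>D. D #> g) (fibre m C)"
  proof (rule inj_on_inverseI)
    fix D assume "D \<in> fibre m C"
    then have "D \<subseteq> carrier G" using sub by (auto simp: fibre_def)
    then show "(D #> g) #> inv g = D"
      using assms by (simp add: coset_mult_assoc coset_mult_one)
  qed
  show "(\<lambda>D. D #> g) ` fibre m C \<subseteq> fibre m (C #> g)"
  proof (safe)
    fix D assume D: "D \<in> fibre m C"
    then obtain a where a: "a \<in> carrier G" "D = \<Gamma> m #> a"
      using rcoset_nonempty[of D m] by (auto simp: fibre_def)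
    then have "D #> g = \<Gamma> m #> (a \<otimes> g)"
      using coset_mult_assoc chain_subset assms by simp
    moreover have "D #> g \<subseteq> C #> g" using D by (auto simp: fibre_def r_coset_def)
    ultimately show "D #> g \<in> fibre m (C #> g)"
      using a assms rcosetsI[OF chain_subset] by (auto simp: fibre_def)
  qed
  show "finite (fibre m (C #> g))"
    using chain_finite_index by (simp add: fibre_def)
qed

lemma fibre_card_eq:
  assumes "C \<in> rcosets \<Gamma> n" "C' \<in> rcosets \<Gamma> n"
  shows "card (fibre m C) \<le> card (fibre m C')"
proof -
  obtain a b where ab: "a \<in> carrier G" "C = \<Gamma> n #> a" "b \<in> carrier G" "C' = \<Gamma> n #> b"
    using assms rcoset_nonempty by meson
  then have "C #> (inv a \<otimes> b) = C'"
    using chain_subset by (simp add: coset_mult_assoc m_assoc[symmetric])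
  then show ?thesis
    using fibre_translate[OF assms(1), of "inv a \<otimes> b" m] ab by simp
qed

lemma fibre_union_card:
  assumes "n \<le> m" "B \<subseteq> rcosets \<Gamma> n" "C \<in> rcosets \<Gamma> n"
  shows "card (\<Union>D\<in>B. fibre m D) = card B * card (fibre m C)"
proof -
  have "card (\<Union>D\<in>B. fibre m D) = (\<Sum>D\<in>B. card (fibre m D))"
  proof (rule card_UN_disjoint)
    show "finite B" using assms chain_finite_index finite_subset by blast
    show "\<forall>D\<in>B. finite (fibre m D)" using chain_finite_index by (simp add: fibre_def)
    show "\<forall>D\<in>B. \<forall>D'\<in>B. D \<noteq> D' \<longrightarrow> fibre m D \<inter> fibre m D' = {}"
    proof (intro ballI impI, rule ccontr)
      fix D D' assume *: "D \<in> B" "D' \<in> B" "D \<noteq> D'" "fibre m D \<inter> fibre m D' \<noteq> {}"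
      then obtain F where "F \<in> rcosets \<Gamma> m" "F \<subseteq> D" "F \<subseteq> D'"
        by (auto simp: fibre_def)
      then show False using parent_unique[of D n D' F m] * assms by blast
    qed
  qed
  also have "\<dots> = (\<Sum>D\<in>B. card (fibre m C))"
    by (rule sum.cong) (use fibre_card_eq assms in \<open>auto intro!: antisym\<close>)
  finally show ?thesis by simp
qed

text \<open>\<open>cyl n B\<close> is the set of rays whose level-\<open>n\<close> coset lies in \<open>B\<close>.\<close>

definition cyl :: "nat \<Rightarrow> 'a set set \<Rightarrow> (nat \<Rightarrow> nat \<times> 'a set) set" where
  "cyl n B = {x \<in> tree_boundary G \<Gamma>. snd (x n) \<in> B}"

definition cylinders :: "(nat \<Rightarrow> nat \<times> 'a set) set set" where
  "cylinders = {cyl n B | n B. B \<subseteq> rcosets \<Gamma> n}"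

definition lev :: "nat \<Rightarrow> (nat \<Rightarrow> nat \<times> 'a set) set \<Rightarrow> 'a set set" where
  "lev n A = (\<lambda>x. snd (x n)) ` A"

definition cyl_mass :: "(nat \<Rightarrow> nat \<times> 'a set) set \<Rightarrow> real" where
  "cyl_mass A = lim (\<lambda>n. real (card (lev n A)) / real (idx n))"

lemma lev_cyl: "B \<subseteq> rcosets \<Gamma> n \<Longrightarrow> lev n (cyl n B) = B"
proof (intro equalityI subsetI)
  fix C assume B: "B \<subseteq> rcosets \<Gamma> n" and "C \<in> B"
  then have "C \<in> (\<lambda>x. snd (x n)) ` tree_boundary G \<Gamma>"
    unfolding level_image by blast
  then obtain x where "x \<in> tree_boundary G \<Gamma>" "C = snd (x n)" by (rule imageE)
  then show "C \<in> lev n (cyl n B)"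
    using \<open>C \<in> B\<close> by (simp add: lev_def cyl_def)
qed (auto simp: lev_def cyl_def)

lemma cyl_refine:
  assumes "n \<le> m" "B \<subseteq> rcosets \<Gamma> n"
  shows "cyl n B = cyl m (\<Union>D\<in>B. fibre m D)"
proof (intro equalityI subsetI)
  fix x assume x: "x \<in> cyl n B"
  then have "x \<in> tree_boundary G \<Gamma>" by (simp add: cyl_def)
  then have "snd (x m) \<in> fibre m (snd (x n))"
    using boundary_snd[of x m] boundary_subset[of x n m] assms by (simp add: fibre_def)
  then show "x \<in> cyl m (\<Union>D\<in>B. fibre m D)" using x by (auto simp: cyl_def)
next
  fix x assume x: "x \<in> cyl m (\<Union>D\<in>B. fibre m D)"
  then obtain D where D: "D \<in> B" "snd (x m) \<subseteq> D" "x \<in> tree_boundary G \<Gamma>"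
    by (auto simp: cyl_def fibre_def)
  then have "snd (x n) = D"
    using parent_unique[of "snd (x n)" n D "snd (x m)" m] boundary_snd boundary_subset assms by blast
  then show "x \<in> cyl n B" using D by (auto simp: cyl_def)
qed

lemma cylinders_common:
  assumes "A \<in> cylinders"
  shows "\<exists>n. \<forall>m\<ge>n. \<exists>B \<subseteq> rcosets \<Gamma> m. A = cyl m B"
proof -
  obtain n B where B: "B \<subseteq> rcosets \<Gamma> n" "A = cyl n B"
    using assms by (auto simp: cylinders_def)
  have "\<exists>B' \<subseteq> rcosets \<Gamma> m. A = cyl m B'" if "n \<le> m" for m
    using cyl_refine[OF that B(1)] B(2)
    by (intro exI[of _ "\<Union>D\<in>B. fibre m D"]) (auto simp: fibre_def)
  then show ?thesis by blast
qed

lemma cylinders_common2: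
  assumes "A \<in> cylinders" "A' \<in> cylinders"
  obtains n B B' where "B \<subseteq> rcosets \<Gamma> n" "A = cyl n B" "B' \<subseteq> rcosets \<Gamma> n" "A' = cyl n B'"
proof -
  obtain k where k: "\<forall>m\<ge>k. \<exists>B \<subseteq> rcosets \<Gamma> m. A = cyl m B"
    using cylinders_common[OF assms(1)] by (rule exE)
  obtain l where l: "\<forall>m\<ge>l. \<exists>B \<subseteq> rcosets \<Gamma> m. A' = cyl m B"
    using cylinders_common[OF assms(2)] by (rule exE)
  from k obtain B where "B \<subseteq> rcosets \<Gamma> (max k l)" "A = cyl (max k l) B"
    by (meson max.cobounded1)
  moreover from l obtain B' where "B' \<subseteq> rcosets \<Gamma> (max k l)" "A' = cyl (max k l) B'"
    by (meson max.cobounded2)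
  ultimately show thesis by (rule that)
qed

lemma cyl_mass:
  assumes "B \<subseteq> rcosets \<Gamma> n"
  shows "cyl_mass (cyl n B) = real (card B) / real (idx n)"
proof -
  have "real (card (lev m (cyl n B))) / real (idx m) = real (card B) / real (idx n)" if "n \<le> m" for m
  proof -
    let ?U = "\<Union>D\<in>B. fibre m D"
    have "lev m (cyl n B) = ?U"
      using cyl_refine[OF that assms] lev_cyl[of ?U m] by (auto simp: fibre_def)
    moreover obtain C where C: "C \<in> rcosets \<Gamma> n"
      using rcosetsI[OF chain_subset one_closed] by blast
    moreover have "card ?U = card B * card (fibre m C)"
      using fibre_union_card that assms C by blast
    moreover have "(\<Union>D\<in>rcosets \<Gamma> n. fibre m D) = rcosets \<Gamma> m"
    proof
      show "rcosets \<Gamma> m \<subseteq> (\<Union>D\<in>rcosets \<Gamma> n. fibre m D)"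
      proof
        fix E assume E: "E \<in> rcosets \<Gamma> m"
        then obtain g where "g \<in> carrier G" "E = \<Gamma> m #> g" using rcoset_nonempty by blast
        then show "E \<in> (\<Union>D\<in>rcosets \<Gamma> n. fibre m D)"
          using E rcoset_mono[OF that, of g] rcosetsI[OF chain_subset, of g n] by (auto simp: fibre_def)
      qed
    qed (auto simp: fibre_def)
    then have "idx m = idx n * card (fibre m C)"
      using fibre_union_card[OF that subset_refl C] by (simp add: idx_def)
    ultimately show ?thesis using idx_pos[of m] idx_pos[of n] by (simp add: field_simps)
  qed
  then have "(\<lambda>m. real (card (lev m (cyl n B))) / real (idx m)) \<longlonglongrightarrow> real (card B) / real (idx n)"
    by (intro tendsto_eventually eventually_sequentiallyI[of n]) blast
  then show ?thesis unfolding cyl_mass_def by (rule limI)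
qed

lemma shadow_cyl: "shadow G \<Gamma> (n, C) = cyl n {C}"
proof -
  have "x n = (n, C) \<longleftrightarrow> snd (x n) = C" if "x \<in> tree_boundary G \<Gamma>" for x
    by (metis boundary_fst[OF that] prod.collapse snd_conv)
  then show ?thesis
    unfolding cyl_def by (blast dest: shadow_iff[THEN iffD1] intro: shadow_iff[THEN iffD2])
qed

lemma algebra_cylinders: "algebra (tree_boundary G \<Gamma>) cylinders"
proof (subst algebra_iff_Un, intro conjI ballI)
  show "cylinders \<subseteq> Pow (tree_boundary G \<Gamma>)"
    by (auto simp: cylinders_def cyl_def)
  show "{} \<in> cylinders"
    unfolding cylinders_def
    by (intro CollectI exI[of _ "0::nat"] exI[of _ "{}"] conjI) (simp_all add: cyl_def)
next
  fix A assume "A \<in> cylinders"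
  then obtain n B where B: "B \<subseteq> rcosets \<Gamma> n" "A = cyl n B" by (auto simp: cylinders_def)
  then have "tree_boundary G \<Gamma> - A = cyl n (rcosets \<Gamma> n - B)"
    using boundary_snd by (auto simp: cyl_def)
  then show "tree_boundary G \<Gamma> - A \<in> cylinders"
    unfolding cylinders_def by (intro CollectI exI conjI) auto
next
  fix A A' assume "A \<in> cylinders" "A' \<in> cylinders"
  then obtain n B B' where B: "B \<subseteq> rcosets \<Gamma> n" "A = cyl n B" "B' \<subseteq> rcosets \<Gamma> n" "A' = cyl n B'"
    by (rule cylinders_common2)
  then have "A \<union> A' = cyl n (B \<union> B')" "B \<union> B' \<subseteq> rcosets \<Gamma> n" by (auto simp: cyl_def)
  then show "A \<union> A' \<in> cylinders"
    unfolding cylinders_def by (intro CollectI exI conjI)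
qed

lemma cyl_boundary: "cyl n (rcosets \<Gamma> n) = tree_boundary G \<Gamma>"
  using boundary_snd by (auto simp: cyl_def)

lemma cylinders_compact:
  assumes A: "range A \<subseteq> cylinders" "decseq A" and ne: "\<And>i. A i \<noteq> {}"
  shows "(\<Inter>i. A (i::nat)) \<noteq> {}"
proof -
  define ok where "ok n C \<longleftrightarrow> C \<in> rcosets \<Gamma> n \<and> (\<forall>i. A i \<inter> cyl n {C} \<noteq> {})" for n C
  have bd: "A i \<subseteq> tree_boundary G \<Gamma>" for i
  proof -
    have "A i \<in> cylinders" using A(1) by blast
    then show ?thesis by (auto simp: cylinders_def cyl_def)
  qed
  have exnext: "\<exists>D \<in> K. \<forall>i. A i \<inter> cyl n {D} \<noteq> {}"
    if K: "K \<subseteq> rcosets \<Gamma> n" "\<And>i. A i \<inter> cyl n K \<noteq> {}" for n K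
  proof (rule ccontr)
    assume "\<not> ?thesis"
    then have "\<forall>D\<in>K. \<exists>i. A i \<inter> cyl n {D} = {}" by blast
    then obtain f where f: "\<forall>D\<in>K. A (f D) \<inter> cyl n {D} = {}" by (rule bchoice[THEN exE])
    have fin: "finite K" using K chain_finite_index finite_subset by blast
    define N where "N = Max (insert 0 (f ` K))"
    have "A N \<inter> cyl n {D} = {}" if "D \<in> K" for D
    proof -
      have "f D \<le> N" unfolding N_def using fin that by (intro Max_ge) auto
      then have "A N \<subseteq> A (f D)" using A(2) by (simp add: decseq_def)
      then show ?thesis using f that by blast
    qed
    moreover have "cyl n K = (\<Union>D\<in>K. cyl n {D})" by (auto simp: cyl_def)
    ultimately have "A N \<inter> cyl n K = {}" by (simp add: Int_UN_distrib)
    then show False using K(2)[of N] by simp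
  qed
  have start: "\<exists>C. ok 0 C"
  proof -
    have "A i \<inter> cyl 0 (rcosets \<Gamma> 0) = A i" for i
      using bd[of i] cyl_boundary[of 0] by blast
    then have "\<exists>D \<in> rcosets \<Gamma> 0. \<forall>i. A i \<inter> cyl 0 {D} \<noteq> {}"
      using ne by (intro exnext) simp_all
    then show ?thesis unfolding ok_def by blast
  qed
  have step: "\<exists>D. ok (Suc n) D \<and> D \<subseteq> C" if "ok n C" for n C
  proof -
    have "cyl n {C} = cyl (Suc n) (fibre (Suc n) C)"
      using cyl_refine[of n "Suc n" "{C}"] that by (simp add: ok_def)
    then have "A i \<inter> cyl (Suc n) (fibre (Suc n) C) \<noteq> {}" for i
      using that by (simp add: ok_def)
    then have "\<exists>D \<in> fibre (Suc n) C. \<forall>i. A i \<inter> cyl (Suc n) {D} \<noteq> {}"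
      by (intro exnext) (simp_all add: fibre_def)
    then show ?thesis unfolding ok_def fibre_def by blast
  qed
  obtain c where c: "\<And>n. ok n (c n)" "\<And>n. c (Suc n) \<subseteq> c n"
    using dependent_nat_choice[of ok "\<lambda>n C D. D \<subseteq> C", OF start step] by auto
  define x where "x n = (n, c n)" for n
  have x: "x \<in> tree_boundary G \<Gamma>"
    unfolding boundary_iff x_def using c(1)[unfolded ok_def] c(2) by simp
  have "x \<in> A i" for i
  proof -
    obtain n B where B: "B \<subseteq> rcosets \<Gamma> n" "A i = cyl n B"
    proof -
      have "A i \<in> cylinders" using A(1) by blast
      then show thesis using that by (auto simp: cylinders_def)
    qed
    have "A i \<inter> cyl n {c n} \<noteq> {}" using c(1) by (simp add: ok_def)
    then have "c n \<in> B" using B by (auto simp: cyl_def)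
    then show ?thesis using x B by (auto simp: cyl_def x_def)
  qed
  then show ?thesis by blast
qed

lemma exists_premeasure_extension:
  "\<exists>\<mu>. (\<forall>A \<in> cylinders. \<mu> A = ennreal (cyl_mass A)) \<and>
        measure_space (tree_boundary G \<Gamma>) (sigma_sets (tree_boundary G \<Gamma>) cylinders) \<mu>"
proof -
  interpret algebra "tree_boundary G \<Gamma>" cylinders by (rule algebra_cylinders)
  have nonneg: "0 \<le> cyl_mass A" if "A \<in> cylinders" for A
    using that by (auto simp: cylinders_def cyl_mass)
  have empty: "cyl_mass {} = 0"
    using cyl_mass[of "{}" 0] by (simp add: cyl_def)
  show ?thesis
  proof (rule caratheodory_empty_continuous)
    show "positive cylinders (\<lambda>A. ennreal (cyl_mass A))"
      by (simp add: positive_def empty)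
    show "additive cylinders (\<lambda>A. ennreal (cyl_mass A))"
      unfolding additive_def
    proof (intro ballI impI)
      fix A A' assume A: "A \<in> cylinders" "A' \<in> cylinders" "A \<inter> A' = {}"
      then obtain n B B' where
        B: "B \<subseteq> rcosets \<Gamma> n" "A = cyl n B" "B' \<subseteq> rcosets \<Gamma> n" "A' = cyl n B'"
        by (meson cylinders_common2)
      have "lev n A \<inter> lev n A' = {}"
        using A(3) B by (auto simp: lev_def cyl_def)
      then have "B \<inter> B' = {}" using B lev_cyl by auto
      moreover have "A \<union> A' = cyl n (B \<union> B')" using B by (auto simp: cyl_def)
      moreover have "finite B" "finite B'" using B chain_finite_index finite_subset by blast+
      ultimately have "cyl_mass (A \<union> A') = cyl_mass A + cyl_mass A'"
        using B by (simp add: cyl_mass card_Un_disjoint add_divide_distrib)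
      then show "ennreal (cyl_mass (A \<union> A')) = ennreal (cyl_mass A) + ennreal (cyl_mass A')"
        using nonneg A by (simp add: ennreal_plus)
    qed
    fix A :: "nat \<Rightarrow> (nat \<Rightarrow> nat \<times> 'a set) set"
    assume A: "range A \<subseteq> cylinders" "decseq A" "(\<Inter>i. A i) = {}"
    then obtain N where N: "A N = {}" using cylinders_compact by blast
    have "A i = {}" if "N \<le> i" for i
      using A(2) N that by (metis decseqD subset_empty)
    then show "(\<lambda>i. ennreal (cyl_mass (A i))) \<longlonglongrightarrow> 0"
      by (intro tendsto_eventually eventually_sequentiallyI[of N]) (simp add: empty)
  qed auto
qed

lemma shadow_in_cylinders:
  assumes "t \<in> coset_tree_vertices G \<Gamma>"
  shows "shadow G \<Gamma> t \<in> cylinders"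
proof -
  have "shadow G \<Gamma> t = cyl (fst t) {snd t}" "{snd t} \<subseteq> rcosets \<Gamma> (fst t)"
    using assms shadow_cyl[of "fst t" "snd t"] by (auto simp: coset_tree_vertices_def)
  then show ?thesis unfolding cylinders_def by (intro CollectI exI conjI)
qed

lemma empty_in_cylinders: "{} \<in> cylinders"
  using algebra_cylinders by (simp add: algebra_iff_Un)

lemma cyl_union_shadows: "B \<subseteq> rcosets \<Gamma> n \<Longrightarrow> cyl n B = (\<Union>C\<in>B. shadow G \<Gamma> (n, C))"
  by (auto simp: shadow_cyl cyl_def)

lemma cylinder_open:
  assumes "A \<in> cylinders"
  shows "openin (boundary_topology G \<Gamma>) A"
proof -
  obtain n B where B: "B \<subseteq> rcosets \<Gamma> n" "A = cyl n B"
    using assms by (auto simp: cylinders_def)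
  have "openin (boundary_topology G \<Gamma>) (shadow G \<Gamma> (n, C))" if "C \<in> B" for C
    unfolding boundary_topology_def
    by (intro topology_generated_by_Basis imageI) (use that B in \<open>auto simp: coset_tree_vertices_def\<close>)
  then have "openin (boundary_topology G \<Gamma>) (\<Union>C\<in>B. shadow G \<Gamma> (n, C))"
    by (intro openin_Union) auto
  then show ?thesis using B cyl_union_shadows by simp
qed

lemma countable_cylinders: "countable cylinders"
proof -
  have "cylinders = (\<Union>n. cyl n ` Pow (rcosets \<Gamma> n))"
    by (auto simp: cylinders_def)
  moreover have "countable (cyl n ` Pow (rcosets \<Gamma> n))" for n
    using chain_finite_index by (intro countable_finite) simp
  ultimately show ?thesis by simp
qed

lemma open_cylinder_union:
  assumes "openin (boundary_topology G \<Gamma>) U" "x \<in> U"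
  shows "\<exists>A \<in> cylinders. x \<in> A \<and> A \<subseteq> U"
proof -
  have Int_in: "A \<inter> B \<in> cylinders" if "A \<in> cylinders" "B \<in> cylinders" for A B
    using algebra_cylinders that by (auto simp: algebra_iff_Int)
  have "generate_topology_on (shadow G \<Gamma> ` coset_tree_vertices G \<Gamma>) U"
    using assms by (auto simp: boundary_topology_def openin_topology_generated_by_iff)
  then show ?thesis using assms(2)
  proof (induction)
    case Empty
    then show ?case by simp
  next
    case (Int a b)
    then have "\<exists>A \<in> cylinders. x \<in> A \<and> A \<subseteq> a" "\<exists>B \<in> cylinders. x \<in> B \<and> B \<subseteq> b"
      by simp_all
    then obtain A B where
      AB: "A \<in> cylinders" "x \<in> A" "A \<subseteq> a" "B \<in> cylinders" "x \<in> B" "B \<subseteq> b"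
      by (elim bexE conjE)
    have "A \<inter> B \<in> cylinders" "x \<in> A \<inter> B" "A \<inter> B \<subseteq> a \<inter> b"
      using Int_in[OF AB(1) AB(4)] AB(2,3,5,6) by auto
    then show ?case by (intro bexI conjI)
  next
    case (UN K)
    from UN.prems obtain k where k: "k \<in> K" "x \<in> k" by (rule UnionE)
    then obtain A where "A \<in> cylinders" "x \<in> A" "A \<subseteq> k" 
      using UN.IH[OF k] by (elim bexE conjE)
    moreover have "k \<subseteq> \<Union>K" using k(1) by (rule Union_upper)
    ultimately show ?case by (meson subset_trans)
  next
    case (Basis s)
    then obtain t where "t \<in> coset_tree_vertices G \<Gamma>" "s = shadow G \<Gamma> t" by blast
    then have "s \<in> cylinders"
      using shadow_in_cylinders by simp
    then show ?case using Basis.prems by (intro bexI[of _ s]) simp_all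
  qed
qed

lemma sigma_sets_cylinders:
  "sigma_sets (tree_boundary G \<Gamma>) {U. openin (boundary_topology G \<Gamma>) U} =
   sigma_sets (tree_boundary G \<Gamma>) cylinders"
proof (rule sigma_sets_eqI)
  fix U assume "U \<in> {U. openin (boundary_topology G \<Gamma>) U}"
  then have U: "U = \<Union>{A \<in> cylinders. A \<subseteq> U}"
    using open_cylinder_union[of U] by blast
  have "\<Union>{A \<in> cylinders. A \<subseteq> U} \<in> sigma_sets (tree_boundary G \<Gamma>) cylinders"
  proof -
    have sp: "cylinders \<subseteq> Pow (tree_boundary G \<Gamma>)"
      by (auto simp: cylinders_def cyl_def)
    have "countable {A \<in> cylinders. A \<subseteq> U}"
      using countable_cylinders by (rule countable_subset[rotated]) auto
    then show ?thesis
      by (rule sigma_algebra.countable_Union[OF sigma_algebra_sigma_sets[OF sp]])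
        (blast intro: sigma_sets.Basic)
  qed
  then show "U \<in> sigma_sets (tree_boundary G \<Gamma>) cylinders"
    by (simp only: U[symmetric])
next
  fix A assume "A \<in> cylinders"
  then show "A \<in> sigma_sets (tree_boundary G \<Gamma>) {U. openin (boundary_topology G \<Gamma>) U}"
    by (intro sigma_sets.Basic CollectI cylinder_open)
qed

lemma sigma_sets_shadows:
  "sigma_sets (tree_boundary G \<Gamma>) {U. openin (boundary_topology G \<Gamma>) U} =
   sigma_sets (tree_boundary G \<Gamma>) (insert {} (shadow G \<Gamma> ` coset_tree_vertices G \<Gamma>))"
  unfolding sigma_sets_cylinders
proof (rule sigma_sets_eqI)
  fix A assume "A \<in> cylinders"
  then obtain n B where B: "B \<subseteq> rcosets \<Gamma> n" "A = cyl n B" by (auto simp: cylinders_def)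
  let ?S = "sigma_sets (tree_boundary G \<Gamma>) (insert {} (shadow G \<Gamma> ` coset_tree_vertices G \<Gamma>))"
  have sp: "insert {} (shadow G \<Gamma> ` coset_tree_vertices G \<Gamma>) \<subseteq> Pow (tree_boundary G \<Gamma>)"
    by (auto simp: shadow_def)
  interpret S: sigma_algebra "tree_boundary G \<Gamma>" ?S
    by (rule sigma_algebra_sigma_sets[OF sp])
  have "finite B" using B chain_finite_index finite_subset by blast
  moreover have "shadow G \<Gamma> (n, C) \<in> ?S" if "C \<in> B" for C
    using that B by (intro sigma_sets.Basic) (auto simp: coset_tree_vertices_def)
  ultimately have "(\<Union>C\<in>B. shadow G \<Gamma> (n, C)) \<in> ?S" by (intro S.finite_UN) auto
  then show "A \<in> ?S" using B cyl_union_shadows by simp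
next
  fix A assume "A \<in> insert {} (shadow G \<Gamma> ` coset_tree_vertices G \<Gamma>)"
  then show "A \<in> sigma_sets (tree_boundary G \<Gamma>) cylinders"
    using shadow_in_cylinders empty_in_cylinders by (intro sigma_sets.Basic) blast
qed

lemma Int_stable_shadows: "Int_stable (insert {} (shadow G \<Gamma> ` coset_tree_vertices G \<Gamma>))"
proof -
  have main: "shadow G \<Gamma> s \<inter> shadow G \<Gamma> t \<in> insert {} (shadow G \<Gamma> ` coset_tree_vertices G \<Gamma>)"
    if st: "s \<in> coset_tree_vertices G \<Gamma>" "t \<in> coset_tree_vertices G \<Gamma>" "fst s \<le> fst t" for s t
  proof (cases "shadow G \<Gamma> s \<inter> shadow G \<Gamma> t = {}")
    case False
    then obtain x where x: "x \<in> shadow G \<Gamma> s" "x \<in> shadow G \<Gamma> t" by blast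
    obtain n C m D where nm: "s = (n, C)" "t = (m, D)" by (metis prod.collapse)
    have "shadow G \<Gamma> t \<subseteq> shadow G \<Gamma> s"
    proof
      fix y assume "y \<in> shadow G \<Gamma> t"
      then show "y \<in> shadow G \<Gamma> s"
        using boundary_agree[of y x m n] x st by (auto simp: nm shadow_iff)
    qed
    then have "shadow G \<Gamma> s \<inter> shadow G \<Gamma> t = shadow G \<Gamma> t" by blast
    then show ?thesis using st by simp
  qed simp
  have main': "shadow G \<Gamma> s \<inter> shadow G \<Gamma> t \<in> insert {} (shadow G \<Gamma> ` coset_tree_vertices G \<Gamma>)"
    if "s \<in> coset_tree_vertices G \<Gamma>" "t \<in> coset_tree_vertices G \<Gamma>" for s t
    using main[of s t] main[of t s] that linear[of "fst s" "fst t"] by (simp only: Int_commute) blast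
  show ?thesis
    unfolding Int_stable_def using main' by blast
qed

theorem boundary_measure_exists_unique: "\<exists>!M. is_boundary_measure G \<Gamma> M"
proof (rule ex_ex1I)
  obtain \<mu> where \<mu>: "\<And>A. A \<in> cylinders \<Longrightarrow> \<mu> A = ennreal (cyl_mass A)"
    "measure_space (tree_boundary G \<Gamma>) (sigma_sets (tree_boundary G \<Gamma>) cylinders) \<mu>"
    using exists_premeasure_extension by blast
  define M where "M = measure_of (tree_boundary G \<Gamma>) cylinders \<mu>"
  have sp: "cylinders \<subseteq> Pow (tree_boundary G \<Gamma>)"
    by (auto simp: cylinders_def cyl_def)
  have space: "space M = tree_boundary G \<Gamma>"
    and sets: "sets M = sigma_sets (tree_boundary G \<Gamma>) cylinders"
    using sp by (simp_all add: M_def space_measure_of sets_measure_of)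
  have em: "emeasure M A = ennreal (cyl_mass A)" if "A \<in> cylinders" for A
    using \<mu> that emeasure_measure_of[OF M_def sp, of A] sigma_sets.Basic[OF that]
    by (simp add: sets measure_space_def)
  have "tree_boundary G \<Gamma> \<in> cylinders" "cyl_mass (tree_boundary G \<Gamma>) = 1"
    using cyl_boundary[of 0] cyl_mass[of "rcosets \<Gamma> 0" 0] idx_pos[of 0]
    by (auto simp: cylinders_def idx_def)
  then have "emeasure M (space M) = 1" using em space by simp
  moreover have "emeasure M (shadow G \<Gamma> (n, C)) = ennreal (1 / real (subgroup_index G (\<Gamma> n)))"
    if "(n, C) \<in> coset_tree_vertices G \<Gamma>" for n C
  proof -
    have C: "C \<in> rcosets \<Gamma> n" using that by (simp add: coset_tree_vertices_def)
    then have "cyl n {C} \<in> cylinders" by (auto simp: cylinders_def)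
    then show ?thesis
      using em shadow_cyl[of n C] cyl_mass[of "{C}" n] C by (simp add: idx_def subgroup_index_def)
  qed
  ultimately show "\<exists>M. is_boundary_measure G \<Gamma> M"
    using space sets by (auto simp: is_boundary_measure_def sigma_sets_cylinders)
next
  fix M N assume M: "is_boundary_measure G \<Gamma> M" and N: "is_boundary_measure G \<Gamma> N"
  let ?E = "insert {} (shadow G \<Gamma> ` coset_tree_vertices G \<Gamma>)"
  have root: "(0, \<Gamma> 0 #> \<one>) \<in> coset_tree_vertices G \<Gamma>"
    using rcosetsI[OF chain_subset one_closed] by (auto simp: coset_tree_vertices_def)
  have "shadow G \<Gamma> (0, \<Gamma> 0 #> \<one>) = tree_boundary G \<Gamma>"
    using chain_subset by (auto simp: shadow_iff tree_boundary_def coset_mult_one)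
  then have bE: "tree_boundary G \<Gamma> \<in> ?E" using root by blast
  show "M = N"
  proof (rule measure_eqI_generator_eq[OF Int_stable_shadows, of "tree_boundary G \<Gamma>" _ _ "\<lambda>_. tree_boundary G \<Gamma>"])
    show "?E \<subseteq> Pow (tree_boundary G \<Gamma>)" by (auto simp: shadow_def)
    show "sets M = sigma_sets (tree_boundary G \<Gamma>) ?E" "sets N = sigma_sets (tree_boundary G \<Gamma>) ?E"
      using M N by (simp_all add: is_boundary_measure_def sigma_sets_shadows)
    fix X assume "X \<in> ?E"
    then show "emeasure M X = emeasure N X"
      using M N by (fastforce simp: is_boundary_measure_def)
  qed (use M bE in \<open>auto simp: is_boundary_measure_def\<close>)
qed

corollary is_boundary_measure_boundary_measure:
  "is_boundary_measure G \<Gamma> (boundary_measure G \<Gamma>)"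
  unfolding boundary_measure_def by (rule theI'[OF boundary_measure_exists_unique])

end

end

theory Submission
  imports Defs
begin

text \<open>
  Write \<open>k\<close> for the index of \<open>\<Gamma> n\<close>, \<open>d\<close> for its minimal number of generators and \<open>r n = (d - 1) / k\<close>.
  The sequence \<open>r\<close> is squeezed to the cost minus one: every \<open>r n\<close> is at least the cost minus one, and
  eventually \<open>r n\<close> is at most any number above it. Both bounds count the edges of a graph with \<open>k\<close>
  vertices.

  \<^bold>\<open>Lower bound for \<open>r\<close>\<close> (\<open>cost_upper_bound\<close>). The shadow of the vertex \<open>\<Gamma> n\<close> has measure \<open>1 / k\<close>, and \<open>\<Gamma> n\<close>
  acts on it. From each of its points draw an edge for each of \<open>d\<close> generators of \<open>\<Gamma> n\<close>, and one edge into
  each of the \<open>k - 1\<close> other shadows of level \<open>n\<close>. The second kind of edge brings any point of the boundary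
  back to the chosen shadow, where orbit equivalence is equivalence under \<open>\<Gamma> n\<close>; so this graph spans, and
  its edge measure is at most \<open>(d + k - 1) / k = r n + 1\<close>.

  \<^bold>\<open>Upper bound for \<open>r\<close>\<close> (\<open>eventually_rank_le_edge_measure\<close>). Let \<open>S\<close> be a spanning Borel graph. Label an edge
  from \<open>x\<close> to \<open>x g\<close> by \<open>g\<close>. Stabilizers are almost surely trivial, so the label is almost surely unique:
  the edge measure of \<open>S\<close> is at least the sum, over any finite set of labels, of the measures of the sets of
  starting points, and a path from \<open>x\<close> to \<open>x q\<close> spells a word whose value in the group is \<open>q\<close> itself. For
  each of finitely many generators \<open>q\<close>, finitely many words therefore serve all points outside a set of
  small measure. These words mention finitely many labels. Replace the set of starting points of each of
  these labels by a cylinder close to it, and drop the other labels; following a fixed word is affected on a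
  small set only, because the action preserves the measure. The points that none of the chosen words serves
  any more form a cylinder of small measure, and drawing the edge from \<open>x\<close> to \<open>x q\<close> there repairs the graph
  at all points (\<open>cylinder_graph_approximation\<close>).

  The new graph is determined by finitely many cylinders, so at every sufficiently large level it is the
  preimage of a finite labelled graph on the right cosets of \<open>\<Gamma> n\<close>, with \<open>k\<close> times the total measure as
  number of edges. In this graph every generator \<open>q\<close> is spelt by a path from each coset \<open>C\<close> to \<open>C q\<close>, so the
  graph is connected and the labels of its closed paths at \<open>\<Gamma> n\<close> fill up \<open>\<Gamma> n\<close>. Its fundamental group is
  free, with one generator for each edge outside a spanning tree, and maps onto \<open>\<Gamma> n\<close>; hence
  \<open>d \<le> edges - (k - 1)\<close> (\<open>coset_graph_generators\<close>, a version of Schreier's lemma stated without the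
  fundamental group). Dividing by \<open>k\<close> bounds \<open>r n\<close> by the total measure minus one.
\<close>

section \<open>Words and labelled graphs\<close>

text \<open>
  A set \<open>A\<close> of pairs \<open>(x, g)\<close> stands for a graph on the points of a right action: the pair is an edge from
  \<open>x\<close> to \<open>x g\<close> with label \<open>g\<close>. The letter \<open>(g, True)\<close> of a word follows such an edge forwards, and
  \<open>(g, False)\<close> follows it backwards. The same notions serve the action on the boundary and the action on the
  cosets of one level, so that a path can be projected from the former to the latter.
\<close>
definition letter_value :: "('a, 'b) monoid_scheme \<Rightarrow> 'a \<times> bool \<Rightarrow> 'a" where
  "letter_value G l = (if snd l then fst l else inv\<^bsub>G\<^esub> (fst l))"

text \<open>
  The edge that a letter uses when it is read at \<open>x\<close>. An edge followed backwards from \<open>x\<close> starts at the point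
  that \<open>g\<close> carries to \<open>x\<close>.
\<close>
definition letter_edge ::
    "('a, 'b) monoid_scheme \<Rightarrow> ('x \<Rightarrow> 'a \<Rightarrow> 'x) \<Rightarrow> 'x \<Rightarrow> 'a \<times> bool \<Rightarrow> 'x \<times> 'a" where
  "letter_edge G act x l = (if snd l then x else act x (inv\<^bsub>G\<^esub> (fst l)), fst l)"

primrec word_value :: "('a, 'b) monoid_scheme \<Rightarrow> ('a \<times> bool) list \<Rightarrow> 'a" where
  "word_value G [] = \<one>\<^bsub>G\<^esub>"
| "word_value G (l # w) = letter_value G l \<otimes>\<^bsub>G\<^esub> word_value G w"

primrec traverses ::
    "('a, 'b) monoid_scheme \<Rightarrow> ('x \<Rightarrow> 'a \<Rightarrow> 'x) \<Rightarrow> ('x \<times> 'a) set \<Rightarrow> ('a \<times> bool) list \<Rightarrow> 'x \<Rightarrow> bool" where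
  "traverses G act A [] x = True"
| "traverses G act A (l # w) x =
     (letter_edge G act x l \<in> A \<and> traverses G act A w (act x (letter_value G l)))"

lemma (in group) letter_value_closed: "fst l \<in> carrier G \<Longrightarrow> letter_value G l \<in> carrier G"
  by (simp add: letter_value_def)

lemma (in group) word_value_closed:
  "w \<in> lists (carrier G \<times> UNIV) \<Longrightarrow> word_value G w \<in> carrier G"
  by (induction w) (auto intro!: m_closed letter_value_closed)

lemma traverses_letters:
  "traverses G act A w x \<Longrightarrow> A \<subseteq> Y \<times> F \<Longrightarrow> w \<in> lists (F \<times> UNIV)"
proof (induction w arbitrary: x)
  case (Cons l w)
  then have "letter_edge G act x l \<in> A" "traverses G act A w (act x (letter_value G l))" by auto
  then show ?case using Cons by (cases l) (auto simp: letter_edge_def)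
qed simp

lemma traverses_mono: "traverses G act A w x \<Longrightarrow> A \<subseteq> B \<Longrightarrow> traverses G act B w x"
  by (induction w arbitrary: x) auto

context group
begin

lemma word_value_append:
  assumes "v \<in> lists (carrier G \<times> UNIV)" "w \<in> lists (carrier G \<times> UNIV)"
  shows "word_value G (v @ w) = word_value G v \<otimes> word_value G w"
  using assms(1)
proof (induction v)
  case Nil
  then show ?case using word_value_closed[OF assms(2)] by simp
next
  case (Cons l v)
  have "letter_value G l \<in> carrier G" using Cons by (auto simp: letter_value_def)
  then show ?case
    using Cons word_value_closed[OF assms(2)] word_value_closed[of v] by (simp add: m_assoc)
qed

lemma generate_words:
  assumes "Q \<subseteq> carrier G" "g \<in> generate G Q"
  shows "g \<in> word_value G ` lists (Q \<times> UNIV)"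
  using assms(2)
proof induction
  case one
  then show ?case by (intro image_eqI[of _ _ "[]"]) auto
next
  case (incl q)
  then show ?case
    using assms by (intro image_eqI[of _ _ "[(q, True)]"]) (auto simp: letter_value_def)
next
  case (inv q)
  then show ?case
    using assms by (intro image_eqI[of _ _ "[(q, False)]"]) (auto simp: letter_value_def)
next
  case (eng g h)
  then obtain v w where vw: "v \<in> lists (Q \<times> UNIV)" "g = word_value G v"
    "w \<in> lists (Q \<times> UNIV)" "h = word_value G w" by blast
  have "lists (Q \<times> (UNIV :: bool set)) \<subseteq> lists (carrier G \<times> UNIV)" using assms by (intro lists_mono) auto
  then have "word_value G (v @ w) = g \<otimes> h"
    using vw word_value_append[of v w] by auto
  moreover have "v @ w \<in> lists (Q \<times> UNIV)" using vw by simp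
  ultimately show ?case by (metis image_eqI)
qed

lemma finitely_generated_countable:
  assumes "finitely_generated G"
  shows "countable (carrier G)"
proof -
  obtain Q where Q: "finite Q" "Q \<subseteq> carrier G" "generate G Q = carrier G"
    using assms by (auto simp: finitely_generated_def)
  have "countable (Q \<times> (UNIV :: bool set))" using Q by (intro countable_finite) simp
  then have "countable (word_value G ` lists (Q \<times> UNIV))" by (intro countable_image countable_lists)
  moreover have "carrier G \<subseteq> word_value G ` lists (Q \<times> UNIV)"
    using generate_words[OF Q(2)] Q(3) by blast
  ultimately show ?thesis using countable_subset by blast
qed

section \<open>Generators of a finite-index subgroup from a connected coset graph\<close>

lemma rcosets_in_carrier: "subgroup H G \<Longrightarrow> C \<in> rcosets H \<Longrightarrow> C \<subseteq> carrier G"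
  using rcosets_subset_PowG by blast

lemma rcosets_translate:
  assumes "subgroup H G" "C \<in> rcosets H" "g \<in> carrier G"
  shows "C #> g \<in> rcosets H"
proof -
  obtain a where a: "a \<in> carrier G" "C = H #> a" using assms(2) by (auto simp: RCOSETS_def)
  then have "C #> g = H #> (a \<otimes> g)"
    using assms subgroup.subset coset_mult_assoc by metis
  then show ?thesis using a assms subgroup.subset rcosetsI by (metis m_closed)
qed

lemma rcosets_translate_mult:
  assumes "subgroup H G" "C \<in> rcosets H" "g \<in> carrier G" "h \<in> carrier G"
  shows "(C #> g) #> h = C #> (g \<otimes> h)"
  using assms coset_mult_assoc rcosets_in_carrier by metis

lemma rcosets_translate_one:
  assumes "subgroup H G" "C \<in> rcosets H"
  shows "C #> \<one> = C"
  using assms coset_mult_one rcosets_in_carrier by metis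

lemma rcosets_translate_inv:
  assumes "subgroup H G" "C \<in> rcosets H" "g \<in> carrier G"
  shows "(C #> g) #> inv g = C" "(C #> inv g) #> g = C"
  using assms rcosets_translate_mult[OF assms(1,2)] rcosets_translate_one by simp_all

lemma subgroup_in_rcosets: "subgroup H G \<Longrightarrow> H \<in> rcosets H"
  using rcosetsI[OF _ one_closed] coset_mult_one subgroup.subset by metis

text \<open>
  The hypothesis is an equivalence because membership in \<open>V\<close> has to be carried backwards along a generator
  too, when \<open>g\<close> involves its inverse.
\<close>
lemma invariant_under_generators:
  assumes "subgroup H G" "Q \<subseteq> carrier G"
    and step: "\<And>C q. C \<in> rcosets H \<Longrightarrow> q \<in> Q \<Longrightarrow> C \<in> V \<longleftrightarrow> C #> q \<in> V"
    and "g \<in> generate G Q" "C \<in> rcosets H"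
  shows "C \<in> V \<longleftrightarrow> C #> g \<in> V"
  using assms(4,5)
proof (induction g arbitrary: C)
  case one
  then show ?case using rcosets_translate_one assms by simp
next
  case (incl q)
  then show ?case using step[OF incl(2) incl(1)] by simp
next
  case (inv q)
  then have "q \<in> carrier G" using assms by auto
  then show ?case
    using step[of "C #> inv q" q] inv assms(1) rcosets_translate[of H C "inv q"]
      rcosets_translate_inv(2)[of H C q] by simp
next
  case (eng g h)
  then have "g \<in> carrier G" "h \<in> carrier G" using assms generate_in_carrier by blast+
  then show ?case
    using eng.IH(1)[OF eng.prems] eng.IH(2)[of "C #> g"] eng.prems assms(1)
      rcosets_translate[of H C g] rcosets_translate_mult[of H C g h] by simp
qed

lemma no_crossing_traverses:
  assumes H: "subgroup H G" and A: "A \<subseteq> (rcosets H) \<times> carrier G"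
    and nc: "\<And>C g. (C, g) \<in> A \<Longrightarrow> C \<in> V \<longleftrightarrow> C #> g \<in> V"
    and "C \<in> rcosets H" "traverses G (r_coset G) A w C"
  shows "C \<in> V \<longleftrightarrow> C #> word_value G w \<in> V"
  using assms(4,5)
proof (induction w arbitrary: C)
  case Nil
  then show ?case using rcosets_translate_one H by simp
next
  case (Cons l w)
  obtain g b where l: "l = (g, b)" by force
  have e: "letter_edge G (r_coset G) C l \<in> A"
    and tr: "traverses G (r_coset G) A w (C #> letter_value G l)" using Cons.prems by auto
  have g: "g \<in> carrier G" using e A by (auto simp: l letter_edge_def)
  have lv: "letter_value G l \<in> carrier G" using g by (simp add: l letter_value_def)
  have wv: "word_value G w \<in> carrier G" using traverses_letters[OF tr A] by (rule word_value_closed)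
  have "C \<in> V \<longleftrightarrow> C #> letter_value G l \<in> V"
    using nc[of C g] nc[of "C #> inv g" g] e rcosets_translate_inv(2)[OF H Cons.prems(1) g]
    by (cases b) (auto simp: l letter_edge_def letter_value_def)
  also have "\<dots> \<longleftrightarrow> (C #> letter_value G l) #> word_value G w \<in> V"
    using Cons.IH[OF _ tr] rcosets_translate[OF H Cons.prems(1) lv] by simp
  finally show ?case using rcosets_translate_mult[OF H Cons.prems(1) lv wv] by simp
qed

text \<open>
  If no edge left or entered \<open>V\<close>, then no path would, so \<open>V\<close> would be invariant under the generators and hence
  under the group, which acts transitively on the cosets.
\<close>
lemma crossing_edge:
  assumes H: "subgroup H G" and Q: "Q \<subseteq> carrier G" "generate G Q = carrier G"
    and A: "A \<subseteq> (rcosets H) \<times> carrier G"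
    and conn: "\<And>C q. C \<in> rcosets H \<Longrightarrow> q \<in> Q \<Longrightarrow>
                 \<exists>w. word_value G w = q \<and> traverses G (r_coset G) A w C"
    and V: "H \<in> V" "D \<in> rcosets H" "D \<notin> V"
  shows "\<exists>C g. (C, g) \<in> A \<and> (C \<in> V \<longleftrightarrow> C #> g \<notin> V)"
proof (rule ccontr)
  assume "\<not> ?thesis"
  then have nc: "\<And>C g. (C, g) \<in> A \<Longrightarrow> C \<in> V \<longleftrightarrow> C #> g \<in> V" by blast
  have st: "C \<in> V \<longleftrightarrow> C #> q \<in> V" if "C \<in> rcosets H" "q \<in> Q" for C q
    using conn[OF that] no_crossing_traverses[OF H A nc that(1)] by blast
  obtain g where g: "g \<in> carrier G" "D = H #> g" using V by (auto simp: RCOSETS_def)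
  then show False
    using invariant_under_generators[OF H Q(1) st, of g H] V Q subgroup_in_rcosets[OF H] by simp
qed

text \<open>
  A tree \<open>T\<close> in the graph \<open>A\<close> with root \<open>H\<close> and vertices \<open>V\<close>, given by what is used of it: the value \<open>t C\<close> of the
  path in the tree from the root to \<open>C\<close> is a coset representative, and the representatives of the two ends
  of a tree edge differ by its label. That there are no cycles is recorded by the number of edges, one fewer
  than the vertices, which \<open>spanning_tree\<close> keeps track of.
\<close>
definition rooted_subtree ::
    "'a set \<Rightarrow> ('a set \<times> 'a) set \<Rightarrow> 'a set set \<Rightarrow> ('a set \<times> 'a) set \<Rightarrow> ('a set \<Rightarrow> 'a) \<Rightarrow> bool" where
  "rooted_subtree H A V T t \<longleftrightarrow>
     V \<subseteq> rcosets H \<and> H \<in> V \<and> T \<subseteq> A \<and> t H = \<one> \<and>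
     (\<forall>C\<in>V. t C \<in> carrier G \<and> H #> t C = C) \<and>
     (\<forall>(C, g)\<in>T. C \<in> V \<and> C #> g \<in> V \<and> t (C #> g) = t C \<otimes> g)"

text \<open>
  The tree grows by one crossing edge at a time, which may point out of the tree or into it; the
  representative of the new vertex is forced by the label.
\<close>
lemma spanning_tree:
  assumes H: "subgroup H G" and Q: "Q \<subseteq> carrier G" "generate G Q = carrier G"
    and fin: "finite (rcosets H)" "finite A" and A: "A \<subseteq> (rcosets H) \<times> carrier G"
    and conn: "\<And>C q. C \<in> rcosets H \<Longrightarrow> q \<in> Q \<Longrightarrow>
                 \<exists>w. word_value G w = q \<and> traverses G (r_coset G) A w C"
    and n: "Suc n \<le> card (rcosets H)"
  shows "\<exists>V T t. rooted_subtree H A V T t \<and> card V = Suc n \<and> card T = n"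
  using n
proof (induction n)
  case 0
  have "H #> \<one> = H" using rcosets_translate_one[OF H subgroup_in_rcosets[OF H]] .
  then have "rooted_subtree H A {H} {} (\<lambda>_. \<one>)"
    using subgroup_in_rcosets[OF H] by (simp add: rooted_subtree_def)
  then show ?case by (intro exI[of _ "{H}"] exI[of _ "{}"] exI[of _ "\<lambda>_. \<one>"]) simp
next
  case (Suc n)
  then have "Suc n \<le> card (rcosets H)" by simp
  from Suc.IH[OF this] obtain V T t
    where tree: "rooted_subtree H A V T t" and cV: "card V = Suc n" and cT: "card T = n"
    by (elim exE conjE)
  have V: "V \<subseteq> rcosets H" "H \<in> V" "card V = Suc n" and T: "T \<subseteq> A" "card T = n" and t1: "t H = \<one>"
    using tree cV cT by (simp_all add: rooted_subtree_def)
  have t: "t C \<in> carrier G \<and> H #> t C = C" if "C \<in> V" for C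
    using tree that unfolding rooted_subtree_def by (elim conjE) (rule bspec)
  have Tt: "C \<in> V \<and> C #> g \<in> V \<and> t (C #> g) = t C \<otimes> g" if "(C, g) \<in> T" for C g
    using tree that unfolding rooted_subtree_def by (elim conjE) (drule bspec, assumption, simp)
  have "V \<noteq> rcosets H" using V Suc.prems by auto
  then obtain D' where "D' \<in> rcosets H" "D' \<notin> V" using V by blast
  then obtain C g where Cg: "(C, g) \<in> A" "C \<in> V \<longleftrightarrow> C #> g \<notin> V"
    using crossing_edge[OF H Q A conn V(2)] by blast
  have Cg': "C \<in> rcosets H" "g \<in> carrier G" "C #> g \<in> rcosets H"
    using Cg A rcosets_translate[OF H] by auto
  \<comment> \<open>The end of the crossing edge that lies outside the tree.\<close>
  define D where "D = (if C \<in> V then C #> g else C)"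
  define t' where "t' = t(D := if C \<in> V then t C \<otimes> g else t (C #> g) \<otimes> inv g)"
  have D: "D \<in> rcosets H" "D \<notin> V" using Cg Cg' by (auto simp: D_def)
  have HG: "H \<subseteq> carrier G" using H subgroup.subset by blast
  have tD: "t' D \<in> carrier G \<and> H #> t' D = D"
  proof (cases "C \<in> V")
    case True
    have "H #> (t C \<otimes> g) = C #> g"
      using t[OF True] Cg'(2) HG by (simp add: coset_mult_assoc[symmetric])
    then show ?thesis using True t[OF True] Cg' by (simp add: t'_def D_def)
  next
    case False
    then have *: "C #> g \<in> V" using Cg by simp
    have "H #> (t (C #> g) \<otimes> inv g) = C"
      using t[OF *] Cg' HG rcosets_translate_inv(1)[OF H Cg'(1,2)]
      by (simp add: coset_mult_assoc[symmetric])
    then show ?thesis using False t[OF *] Cg' by (simp add: t'_def D_def)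
  qed
  have new: "t' (C #> g) = t' C \<otimes> g"
  proof (cases "C \<in> V")
    case True
    then have "C \<noteq> C #> g" using Cg by auto
    then show ?thesis using True by (simp add: t'_def D_def)
  next
    case False
    then have "C #> g \<in> V" "C \<noteq> C #> g" using Cg by auto
    then show ?thesis using False t[of "C #> g"] Cg' by (simp add: t'_def D_def m_assoc)
  qed
  have "(C, g) \<notin> T" using Tt Cg by blast
  moreover have "finite V" using V fin finite_subset by blast
  moreover have "finite T" using T fin finite_subset by blast
  ultimately have cards: "card (insert D V) = Suc (Suc n)" "card (insert (C, g) T) = Suc n"
    using V T D by simp_all
  have "rooted_subtree H A (insert D V) (insert (C, g) T) t'"
    unfolding rooted_subtree_def
  proof (intro conjI ballI)
    show "insert D V \<subseteq> rcosets H" "H \<in> insert D V" "insert (C, g) T \<subseteq> A"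
      using V D T Cg by auto
    show "t' H = \<one>" using t1 V D by (auto simp: t'_def)
    show "t' E \<in> carrier G" "H #> t' E = E" if "E \<in> insert D V" for E
      using that tD t by (auto simp: t'_def)
    show "case p of (C', g') \<Rightarrow> C' \<in> insert D V \<and> C' #> g' \<in> insert D V \<and> t' (C' #> g') = t' C' \<otimes> g'"
      if p_in: "p \<in> insert (C, g) T" for p
    proof (cases "p = (C, g)")
      case True
      then show ?thesis using new Cg by (auto simp: D_def)
    next
      case False
      then obtain C' g' where p: "p = (C', g')" "(C', g') \<in> T"
        using p_in by (metis insertE prod.collapse)
      then show ?thesis using Tt[OF p(2)] D(2) by (auto simp: t'_def)
    qed
  qed
  then show ?case using cards by (intro exI conjI)
qed

text \<open>
  Schreier's lemma for a graph whose labels need not be the given generators. With representatives \<open>t\<close> from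
  a spanning tree, the Schreier elements \<open>s C g = t C \<otimes> g \<otimes> inv (t (C #> g))\<close> lie in \<open>H\<close> and form a cocycle, so
  the value of a path starting at \<open>C\<close> has a Schreier element that is a product of those of its edges and
  their inverses. Since paths spell the generators of the group from every coset, every element of \<open>H\<close>,
  which is its own Schreier element at the coset \<open>H\<close>, is such a product. The tree edges have trivial
  Schreier elements, and there is one fewer of them than cosets.
\<close>
lemma coset_graph_generators:
  assumes H: "subgroup H G" and Q: "Q \<subseteq> carrier G" "generate G Q = carrier G"
    and fin: "finite (rcosets H)" "finite A" and A: "A \<subseteq> (rcosets H) \<times> carrier G"
    and conn: "\<And>C q. C \<in> rcosets H \<Longrightarrow> q \<in> Q \<Longrightarrow>
                 \<exists>w. word_value G w = q \<and> traverses G (r_coset G) A w C"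
  shows "\<exists>D. finite D \<and> D \<subseteq> H \<and> generate (G\<lparr>carrier := H\<rparr>) D = H \<and>
             card D + card (rcosets H) \<le> card A + 1"
proof -
  have HG: "H \<subseteq> carrier G" using H subgroup.subset by blast
  have "card (rcosets H) > 0" using fin subgroup_in_rcosets[OF H] card_gt_0_iff by blast
  then obtain n where n: "card (rcosets H) = Suc n" using gr0_conv_Suc by blast
  have "\<exists>V T t. rooted_subtree H A V T t \<and> card V = Suc n \<and> card T = n"
    by (rule spanning_tree[OF H Q fin A]) (auto simp: n intro: conn)
  then obtain V T t where tree: "rooted_subtree H A V T t" and cV: "card V = Suc n" and cT: "card T = n"
    by (elim exE conjE)
  have V: "V \<subseteq> rcosets H" "card V = Suc n" and T: "T \<subseteq> A" "card T = n" and t1: "t H = \<one>"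
    and tV: "\<forall>C\<in>V. t C \<in> carrier G \<and> H #> t C = C"
    and Tt: "\<forall>(C, g)\<in>T. C \<in> V \<and> C #> g \<in> V \<and> t (C #> g) = t C \<otimes> g"
    using tree cV cT unfolding rooted_subtree_def by simp_all
  have "V = rcosets H" using V n fin card_subset_eq by metis
  then have t: "t C \<in> carrier G" "H #> t C = C" if "C \<in> rcosets H" for C
    using tV that by auto
  define s where "s C g = t C \<otimes> g \<otimes> inv (t (C #> g))" for C g
  define D where "D = case_prod s ` (A - T)"
  have sH: "s C g \<in> H" if C: "C \<in> rcosets H" and g: "g \<in> carrier G" for C g
  proof -
    note C' = rcosets_translate[OF H C g]
    have "H #> s C g = C #> g #> inv (t (C #> g))"
      using t[OF C] t[OF C'] g HG by (simp add: s_def coset_mult_assoc[symmetric])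
    also have "\<dots> = H #> t (C #> g) #> inv (t (C #> g))" using t[OF C'] by simp
    also have "\<dots> = H"
      using t(1)[OF C'] rcosets_translate_inv[OF H subgroup_in_rcosets[OF H]] by simp
    finally show ?thesis using coset_join1[OF _ _ H] t(1)[OF C] t(1)[OF C'] g by (simp add: s_def)
  qed
  have DH: "D \<subseteq> H" using sH A by (auto simp: D_def)
  have DG: "D \<subseteq> carrier G" using DH HG by blast
  have K: "subgroup (generate G D) G" using DG by (rule generate_is_subgroup)
  have KG: "k \<in> carrier G" if "k \<in> generate G D" for k using that DG generate_in_carrier by blast
  have sA: "s C g \<in> generate G D" if "(C, g) \<in> A" for C g
  proof (cases "(C, g) \<in> T")
    case True
    then have "t (C #> g) = t C \<otimes> g" using Tt by auto
    moreover have "C \<in> rcosets H" "g \<in> carrier G" using that A by auto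
    ultimately have "s C g = \<one>" using t[of C] by (simp add: s_def)
    then show ?thesis by (simp add: generate.one)
  next
    case False
    then show ?thesis using that by (intro generate.incl) (force simp: D_def)
  qed
  have s_mult: "s C (g \<otimes> h) = s C g \<otimes> s (C #> g) h"
    if C: "C \<in> rcosets H" and g: "g \<in> carrier G" "h \<in> carrier G" for C g h
  proof -
    note 1 = rcosets_translate[OF H C g(1)]
    note 2 = rcosets_translate[OF H 1 g(2)]
    have "inv (t (C #> g)) \<otimes> (t (C #> g) \<otimes> y) = y" if "y \<in> carrier G" for y
      using t(1)[OF 1] that by (simp add: m_assoc[symmetric])
    then show ?thesis
      using t(1)[OF C] t(1)[OF 1] t(1)[OF 2] g rcosets_translate_mult[OF H C g]
      by (simp add: s_def m_assoc)
  qed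
  have s_one: "s C \<one> = \<one>" if "C \<in> rcosets H" for C
    using t[OF that] rcosets_translate_one[OF H that] by (simp add: s_def)
  have s_inv: "s C (inv g) = inv (s (C #> inv g) g)" if C: "C \<in> rcosets H" and g: "g \<in> carrier G" for C g
  proof -
    have C': "C #> inv g \<in> rcosets H" using rcosets_translate[OF H C] g by simp
    show ?thesis
      using t(1)[OF C] t(1)[OF C'] g rcosets_translate_inv(2)[OF H C g]
      by (simp add: s_def inv_mult_group m_assoc)
  qed
  have s_word: "s C (word_value G w) \<in> generate G D"
    if "C \<in> rcosets H" "traverses G (r_coset G) A w C" for C w
    using that
  proof (induction w arbitrary: C)
    case Nil
    then show ?case using s_one by (simp add: generate.one)
  next
    case (Cons l w)
    obtain g b where l: "l = (g, b)" by force
    have e: "letter_edge G (r_coset G) C l \<in> A"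
      and tr: "traverses G (r_coset G) A w (C #> letter_value G l)" using Cons.prems by auto
    have g: "g \<in> carrier G" using e A by (auto simp: l letter_edge_def)
    have lv: "letter_value G l \<in> carrier G" using g by (simp add: l letter_value_def)
    have wv: "word_value G w \<in> carrier G" using traverses_letters[OF tr A] by (rule word_value_closed)
    have "s C (letter_value G l) \<in> generate G D"
      using e sA s_inv[OF Cons.prems(1) g] subgroup.m_inv_closed[OF K]
      by (cases b) (auto simp: l letter_edge_def letter_value_def)
    moreover have "s (C #> letter_value G l) (word_value G w) \<in> generate G D"
      using Cons.IH[OF _ tr] rcosets_translate[OF H Cons.prems(1) lv] by simp
    ultimately show ?case
      using s_mult[OF Cons.prems(1) lv wv] by (simp add: generate.eng)
  qed
  have s_all: "s C g \<in> generate G D" if "g \<in> generate G Q" "C \<in> rcosets H" for C g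
    using that
  proof (induction g arbitrary: C)
    case one
    then show ?case using s_one by (simp add: generate.one)
  next
    case (incl q)
    then show ?case using conn s_word by metis
  next
    case (inv q)
    then have q: "q \<in> carrier G" using Q by blast
    then have C': "C #> inv q \<in> rcosets H" using rcosets_translate[OF H] inv by simp
    then have "s (C #> inv q) q \<in> generate G D" using conn[OF C'] inv s_word[OF C'] by metis
    then show ?case using s_inv[OF inv(2) q] subgroup.m_inv_closed[OF K] by simp
  next
    case (eng g h)
    then have gh: "g \<in> carrier G" "h \<in> carrier G" using Q by auto
    then show ?case
      using eng s_mult[OF eng.prems gh] rcosets_translate[OF H eng.prems gh(1)]
      by (simp add: generate.eng)
  qed
  have "generate G D = H"
  proof
    show "generate G D \<subseteq> H" using DH H by (rule generate_subgroup_incl)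
    show "H \<subseteq> generate G D"
    proof
      fix h assume h: "h \<in> H"
      then have "s H h = h"
        using HG t1 coset_join2[of h H] H by (auto simp: s_def)
      then show "h \<in> generate G D"
        using s_all[of h H] Q h HG subgroup_in_rcosets[OF H] by auto
    qed
  qed
  then have "generate (G\<lparr>carrier := H\<rparr>) D = H" using generate_consistent[OF DH H] by simp
  moreover have "finite D" using fin by (simp add: D_def)
  moreover have "card D \<le> card (A - T)" unfolding D_def using fin by (intro card_image_le) auto
  then have "card D + card (rcosets H) \<le> card A + 1"
    using T n fin card_mono[OF fin(2) T(1)] card_Diff_subset[of T A] finite_subset[OF T(1)] by simp
  ultimately show ?thesis using DH by blast
qed

end

section \<open>The action on the boundary\<close>

context finite_index_chain
begin

abbreviation "X \<equiv> tree_boundary G \<Gamma>"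
abbreviation "\<mu> \<equiv> boundary_measure G \<Gamma>"

lemma space_boundary_measure [simp]: "space \<mu> = X"
  and sets_boundary_measure: "sets \<mu> = sigma_sets X cylinders"
  using is_boundary_measure_boundary_measure
  by (simp_all add: is_boundary_measure_def sigma_sets_cylinders)

lemma emeasure_space_boundary: "emeasure \<mu> X = 1"
  using is_boundary_measure_boundary_measure space_boundary_measure
  unfolding is_boundary_measure_def by metis

lemma emeasure_shadow:
  "C \<in> rcosets \<Gamma> n \<Longrightarrow> emeasure \<mu> (shadow G \<Gamma> (n, C)) = ennreal (1 / real (idx n))"
  using is_boundary_measure_boundary_measure
  by (auto simp: is_boundary_measure_def coset_tree_vertices_def idx_def subgroup_index_def)

lemma finite_boundary_measure: "finite_measure \<mu>"
  by standard (simp add: emeasure_space_boundary)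

lemma measure_union_le:
  assumes "A \<in> sets \<mu>" "B \<in> sets \<mu>"
  shows "measure \<mu> (A \<union> B) \<le> measure \<mu> A + measure \<mu> B"
proof -
  interpret finite_measure \<mu> by (rule finite_boundary_measure)
  show ?thesis using assms by (intro measure_subadditive) simp_all
qed

lemma cylinder_sets: "A \<in> cylinders \<Longrightarrow> A \<in> sets \<mu>"
  by (simp add: sets_boundary_measure sigma_sets.Basic)

lemma cyl_sets: "B \<subseteq> rcosets \<Gamma> n \<Longrightarrow> cyl n B \<in> sets \<mu>"
  by (rule cylinder_sets) (auto simp: cylinders_def)

lemma measure_cyl:
  assumes "B \<subseteq> rcosets \<Gamma> n"
  shows "measure \<mu> (cyl n B) = real (card B) / real (idx n)"
proof -
  interpret finite_measure \<mu> by (rule finite_boundary_measure)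
  have fin: "finite B" using assms chain_finite_index finite_subset by blast
  have "measure \<mu> (\<Union>C\<in>B. cyl n {C}) = (\<Sum>C\<in>B. measure \<mu> (cyl n {C}))"
  proof (rule finite_measure_finite_Union[OF fin])
    show "(\<lambda>C. cyl n {C}) ` B \<subseteq> sets \<mu>" using assms cyl_sets by blast
    show "disjoint_family_on (\<lambda>C. cyl n {C}) B" by (auto simp: disjoint_family_on_def cyl_def)
  qed
  also have "\<dots> = (\<Sum>C\<in>B. 1 / real (idx n))"
  proof (rule sum.cong)
    fix C assume "C \<in> B"
    then have "emeasure \<mu> (cyl n {C}) = ennreal (1 / real (idx n))"
      using assms emeasure_shadow shadow_cyl by (metis subsetD)
    then show "measure \<mu> (cyl n {C}) = 1 / real (idx n)" by (simp add: measure_def)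
  qed simp
  also have "(\<Union>C\<in>B. cyl n {C}) = cyl n B" by (auto simp: cyl_def)
  finally show ?thesis by simp
qed

text \<open>
  Each level has finitely many cosets, so the sets of rays through a single vertex are enough.
\<close>
lemma boundary_measurableI:
  assumes "f \<in> space N \<rightarrow> X"
    and "\<And>n C. C \<in> rcosets \<Gamma> n \<Longrightarrow> {y \<in> space N. snd (f y n) = C} \<in> sets N"
  shows "f \<in> measurable N \<mu>"
proof -
  have sp: "cylinders \<subseteq> Pow X" by (auto simp: cylinders_def cyl_def)
  have "f \<in> measurable N (sigma X cylinders)"
  proof (rule measurable_measure_of[OF sp assms(1)])
    fix A assume "A \<in> cylinders"
    then obtain n B where B: "B \<subseteq> rcosets \<Gamma> n" "A = cyl n B" by (auto simp: cylinders_def)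
    then have "f -` A \<inter> space N = (\<Union>C\<in>B. {y \<in> space N. snd (f y n) = C})"
      using assms(1) by (auto simp: cyl_def)
    moreover have "finite B" using B chain_finite_index finite_subset by blast
    ultimately show "f -` A \<inter> space N \<in> sets N"
      using B assms(2) by (auto intro!: sets.finite_UN)
  qed
  moreover have "sets (sigma X cylinders) = sets \<mu>"
    using sp by (simp add: sets_boundary_measure)
  ultimately show ?thesis using measurable_cong_sets by blast
qed

lemma snd_action [simp]: "snd (boundary_action G x g n) = snd (x n) #> g"
  and fst_action [simp]: "fst (boundary_action G x g n) = fst (x n)"
  by (simp_all add: boundary_action_def)

lemma boundary_eqI:
  assumes "x \<in> X" "y \<in> X" "\<And>n. snd (x n) = snd (y n)"
  shows "x = y"
  using assms boundary_fst by (intro ext prod_eqI) simp_all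

lemma action_closed:
  assumes "x \<in> X" "g \<in> carrier G"
  shows "boundary_action G x g \<in> X"
  unfolding boundary_iff
proof (intro allI conjI)
  fix n
  show "fst (boundary_action G x g n) = n" using assms boundary_fst by simp
  show "snd (boundary_action G x g n) \<in> rcosets \<Gamma> n"
    using assms rcosets_translate[OF chain_subgroup] boundary_snd by simp
  show "snd (boundary_action G x g (Suc n)) \<subseteq> snd (boundary_action G x g n)"
    using assms boundary_subset[of x n "Suc n"] by (auto simp: r_coset_def)
qed

lemma action_one: "x \<in> X \<Longrightarrow> boundary_action G x \<one> = x"
  using rcosets_translate_one[OF chain_subgroup] boundary_snd
  by (intro boundary_eqI action_closed) auto

lemma action_mult:
  assumes "x \<in> X" "g \<in> carrier G" "h \<in> carrier G"
  shows "boundary_action G (boundary_action G x g) h = boundary_action G x (g \<otimes> h)"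
  using assms rcosets_translate_mult[OF chain_subgroup boundary_snd[OF assms(1)]]
  by (intro boundary_eqI action_closed) simp_all

lemma action_inv:
  assumes "x \<in> X" "g \<in> carrier G"
  shows "boundary_action G (boundary_action G x g) (inv g) = x"
    "boundary_action G (boundary_action G x (inv g)) g = x"
  using assms by (simp_all add: action_mult action_one)

lemma translate_eq_iff:
  assumes "C \<in> rcosets \<Gamma> n" "D \<in> rcosets \<Gamma> n" "g \<in> carrier G"
  shows "C #> g = D \<longleftrightarrow> C = D #> inv g"
  using assms rcosets_translate_inv[OF chain_subgroup] by metis

lemma action_vimage_cyl:
  assumes "C \<in> rcosets \<Gamma> n" "g \<in> carrier G"
  shows "{x \<in> X. snd (x n) #> g = C} = cyl n {C #> inv g}"
  using assms translate_eq_iff boundary_snd unfolding cyl_def by blast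

lemma action_measurable:
  assumes g: "g \<in> carrier G"
  shows "(\<lambda>x. boundary_action G x g) \<in> measurable \<mu> \<mu>"
proof (rule boundary_measurableI)
  fix n C assume C: "C \<in> rcosets \<Gamma> n"
  have "{x \<in> space \<mu>. snd (boundary_action G x g n) = C} = cyl n {C #> inv g}"
    using action_vimage_cyl[OF C g] by simp
  then show "{x \<in> space \<mu>. snd (boundary_action G x g n) = C} \<in> sets \<mu>"
    using C g rcosets_translate[OF chain_subgroup] by (simp add: cyl_sets)
qed (use action_closed g in auto)

text \<open>
  Right translation permutes the shadows of each level. Hence the image measure has the properties that
  characterise the boundary measure.
\<close>
lemma action_distr:
  assumes g: "g \<in> carrier G"
  shows "distr \<mu> \<mu> (\<lambda>x. boundary_action G x g) = \<mu>" (is "?D = _")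
proof -
  note [measurable] = action_measurable[OF g]
  have "emeasure ?D (shadow G \<Gamma> (n, C)) = ennreal (1 / real (subgroup_index G (\<Gamma> n)))"
    if "(n, C) \<in> coset_tree_vertices G \<Gamma>" for n C
  proof -
    have C: "C \<in> rcosets \<Gamma> n" using that by (simp add: coset_tree_vertices_def)
    have "(\<lambda>x. boundary_action G x g) -` cyl n {C} \<inter> X = cyl n {C #> inv g}"
      using action_vimage_cyl[OF C g] action_closed[OF _ g] by (auto simp: cyl_def)
    moreover have "C #> inv g \<in> rcosets \<Gamma> n" using C g rcosets_translate[OF chain_subgroup] by simp
    ultimately show ?thesis
      using C cyl_sets[of "{C}" n] emeasure_shadow[of "C #> inv g" n]
      by (simp add: emeasure_distr shadow_cyl idx_def subgroup_index_def)
  qed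
  moreover have "emeasure ?D X = 1"
  proof -
    have "(\<lambda>x. boundary_action G x g) -` X \<inter> X = X" using action_closed g by auto
    moreover have "X \<in> sets \<mu>" using sets.top[of \<mu>] by simp
    ultimately show ?thesis by (simp add: emeasure_distr emeasure_space_boundary)
  qed
  ultimately have "is_boundary_measure G \<Gamma> ?D"
    using is_boundary_measure_boundary_measure by (auto simp: is_boundary_measure_def)
  then show ?thesis
    using boundary_measure_exists_unique is_boundary_measure_boundary_measure by blast
qed

lemma measure_translate:
  assumes "g \<in> carrier G" "A \<in> sets \<mu>"
  shows "measure \<mu> {x \<in> X. boundary_action G x g \<in> A} = measure \<mu> A"
proof -
  have "measure \<mu> A = measure (distr \<mu> \<mu> (\<lambda>x. boundary_action G x g)) A"
    using action_distr[OF assms(1)] by simp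
  also have "\<dots> = measure \<mu> {x \<in> X. boundary_action G x g \<in> A}"
    using assms(2) by (subst measure_distr[OF action_measurable[OF assms(1)]])
      (auto intro!: arg_cong[where f = "measure \<mu>"])
  finally show ?thesis by simp
qed

lemma sets_translate:
  assumes "g \<in> carrier G" "A \<in> sets \<mu>"
  shows "{x \<in> X. boundary_action G x g \<in> A} \<in> sets \<mu>"
  using measurable_sets[OF action_measurable[OF assms(1)] assms(2)]
  by (simp add: vimage_def Int_def conj_commute)

text \<open>
  The coordinates of a ray separate points: \<open>y = x g\<close> amounts to countably many conditions, one for each
  level, and each of them is a finite union of rectangles.
\<close>
lemma action_graph_sets:
  assumes g: "g \<in> carrier G" and A: "A \<in> sets \<mu>"
  shows "(\<lambda>x. (x, boundary_action G x g)) ` A \<in> sets (\<mu> \<Otimes>\<^sub>M \<mu>)"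
proof -
  have AX: "A \<subseteq> X" using sets.sets_into_space[OF A] by simp
  have "(\<lambda>x. (x, boundary_action G x g)) ` A =
    (A \<times> X) \<inter> (\<Inter>n. \<Union>C\<in>rcosets \<Gamma> n. cyl n {C} \<times> cyl n {C #> g})" (is "?L = ?R")
  proof
    show "?L \<subseteq> ?R" using AX g boundary_snd by (auto simp: cyl_def action_closed)
    show "?R \<subseteq> ?L"
    proof
      fix p assume p: "p \<in> ?R"
      obtain x y where xy: "p = (x, y)" by force
      then have x: "x \<in> A" "x \<in> X" "y \<in> X" using p AX by auto
      have "snd (y n) = snd (x n) #> g" for n
        using p xy by (auto simp: cyl_def)
      then have "y = boundary_action G x g"
        using x g by (intro boundary_eqI action_closed) auto
      then show "p \<in> ?L" using x xy by auto
    qed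
  qed
  moreover have "(\<Union>C\<in>rcosets \<Gamma> n. cyl n {C} \<times> cyl n {C #> g}) \<in> sets (\<mu> \<Otimes>\<^sub>M \<mu>)" for n
    using chain_finite_index rcosets_translate[OF chain_subgroup _ g]
    by (intro sets.finite_UN pair_measureI cyl_sets) auto
  moreover have "A \<times> X \<in> sets (\<mu> \<Otimes>\<^sub>M \<mu>)"
    using A sets.top[of \<mu>] by (intro pair_measureI) simp_all
  ultimately show ?thesis by (auto intro!: sets.countable_INT')
qed

section \<open>The cost is at most one plus the normalised rank\<close>

text \<open>
  All edges labelled by a finite generating set form a coset graph in which each generator is spelt by a
  word of length one.
\<close>
lemma schreier_finite_generators:
  assumes "finitely_generated G"
  shows "\<exists>D. finite D \<and> D \<subseteq> \<Gamma> n \<and> generate (G\<lparr>carrier := \<Gamma> n\<rparr>) D = \<Gamma> n"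
proof -
  obtain Q where Q: "finite Q" "Q \<subseteq> carrier G" "generate G Q = carrier G"
    using assms by (auto simp: finitely_generated_def)
  have w: "word_value G [(q, True)] = q \<and> traverses G (r_coset G) ((rcosets \<Gamma> n) \<times> Q) [(q, True)] C"
    if "C \<in> rcosets \<Gamma> n" "q \<in> Q" for C q
    using that Q by (auto simp: letter_value_def letter_edge_def)
  have "\<exists>D. finite D \<and> D \<subseteq> \<Gamma> n \<and> generate (G\<lparr>carrier := \<Gamma> n\<rparr>) D = \<Gamma> n \<and>
      card D + card (rcosets \<Gamma> n) \<le> card ((rcosets \<Gamma> n) \<times> Q) + 1"
    by (rule coset_graph_generators[OF chain_subgroup Q(2,3)])
      (use Q chain_finite_index w in blast)+
  then show ?thesis by blast
qed

lemma min_generators_le: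
  assumes "finite D" "D \<subseteq> \<Gamma> n" "generate (G\<lparr>carrier := \<Gamma> n\<rparr>) D = \<Gamma> n"
  shows "min_generators (G\<lparr>carrier := \<Gamma> n\<rparr>) \<le> card D"
  unfolding min_generators_def by (rule Least_le) (use assms in auto)

text \<open>
  The number \<open>min_generators\<close> is a \<open>LEAST\<close>, which says something only if a finite generating set exists; this
  is why Schreier's lemma is needed for this direction of the theorem too.
\<close>
lemma min_generators_attained:
  assumes "finitely_generated G"
  obtains D where "finite D" "D \<subseteq> \<Gamma> n" "generate G D = \<Gamma> n"
    "card D = min_generators (G\<lparr>carrier := \<Gamma> n\<rparr>)"
proof -
  have "\<exists>k D. finite D \<and> D \<subseteq> \<Gamma> n \<and> generate (G\<lparr>carrier := \<Gamma> n\<rparr>) D = \<Gamma> n \<and> card D = k"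
    using schreier_finite_generators[OF assms, of n] by auto
  from LeastI_ex[OF this]
  have "\<exists>D. finite D \<and> D \<subseteq> \<Gamma> n \<and> generate (G\<lparr>carrier := \<Gamma> n\<rparr>) D = \<Gamma> n \<and>
      card D = min_generators (G\<lparr>carrier := \<Gamma> n\<rparr>)"
    by (simp add: min_generators_def)
  then obtain D where D: "finite D" "D \<subseteq> \<Gamma> n" "generate (G\<lparr>carrier := \<Gamma> n\<rparr>) D = \<Gamma> n"
      "card D = min_generators (G\<lparr>carrier := \<Gamma> n\<rparr>)"
    by (elim exE conjE)
  show thesis
    using that[OF D(1,2) _ D(4)] D(3) generate_consistent[OF D(2) chain_subgroup] by simp
qed

text \<open>
  The graph consists of the edges from \<open>x\<close> to \<open>x g\<close> where \<open>x\<close> runs through the shadow \<open>X1\<close> of the vertex \<open>\<Gamma> n\<close>, and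
  \<open>g\<close> through generators of \<open>\<Gamma> n\<close> and representatives of the nontrivial cosets. Out-degrees are at most the
  number of these elements.
\<close>
lemma cost_upper_bound:
  assumes fg: "finitely_generated G"
  shows "cost \<mu> (boundary_orbit_relation G \<Gamma>) \<le>
    ennreal ((real (min_generators (G\<lparr>carrier := \<Gamma> n\<rparr>)) + real (idx n) - 1) / real (idx n))"
proof -
  obtain D where D: "finite D" "D \<subseteq> \<Gamma> n" "generate G D = \<Gamma> n"
    "card D = min_generators (G\<lparr>carrier := \<Gamma> n\<rparr>)"
    using min_generators_attained[OF fg] by blast
  have \<Gamma>_coset: "\<Gamma> n \<in> rcosets \<Gamma> n" by (rule subgroup_in_rcosets[OF chain_subgroup])
  define X1 where "X1 = cyl n {\<Gamma> n}"
  have "\<forall>C\<in>rcosets \<Gamma> n. \<exists>g. g \<in> carrier G \<and> \<Gamma> n #> g = C" by (auto simp: RCOSETS_def)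
  then obtain t where t: "\<And>C. C \<in> rcosets \<Gamma> n \<Longrightarrow> t C \<in> carrier G \<and> \<Gamma> n #> t C = C"
    by metis
  \<comment> \<open>The coset \<open>\<Gamma> n\<close> itself is left out: this is the \<open>- 1\<close> in the bound.\<close>
  define R where "R = D \<union> t ` (rcosets \<Gamma> n - {\<Gamma> n})"
  define S where "S = (\<Union>g\<in>R. (\<lambda>x. (x, boundary_action G x g)) ` X1)"
  have R: "finite R" "R \<subseteq> carrier G"
    using D(1,2) chain_finite_index t chain_subset[of n] by (auto simp: R_def)
  have X1: "X1 \<in> sets \<mu>" "X1 \<subseteq> X"
    using \<Gamma>_coset cyl_sets[of "{\<Gamma> n}" n] by (auto simp: X1_def cyl_def)
  have cR: "card R \<le> card D + (idx n - 1)"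
  proof -
    have "card R \<le> card D + card (t ` (rcosets \<Gamma> n - {\<Gamma> n}))" unfolding R_def by (rule card_Un_le)
    also have "card (t ` (rcosets \<Gamma> n - {\<Gamma> n})) \<le> card (rcosets \<Gamma> n - {\<Gamma> n})"
      using chain_finite_index by (intro card_image_le) simp
    also have "\<dots> = idx n - 1" using \<Gamma>_coset by (simp add: idx_def)
    finally show ?thesis by simp
  qed
  have bsub: "borel_subgraph \<mu> (boundary_orbit_relation G \<Gamma>) S"
    unfolding borel_subgraph_def
  proof
    show "S \<in> sets (\<mu> \<Otimes>\<^sub>M \<mu>)"
      unfolding S_def using R X1 by (intro sets.finite_UN action_graph_sets) auto
    show "S \<subseteq> boundary_orbit_relation G \<Gamma>"
      using X1 R action_closed
      by (auto simp: S_def boundary_orbit_relation_def orbit_relation_def)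
  qed
  let ?P = "(S \<union> S\<inverse>)\<^sup>*"
  have sym: "(x, y) \<in> ?P \<Longrightarrow> (y, x) \<in> ?P" for x y
    using sym_rtrancl[OF sym_Un_converse, of S] by (rule symD)
  have X1_iff: "boundary_action G x h \<in> X1" if "x \<in> X1" "h \<in> \<Gamma> n" for x h
    using that subsetD[OF chain_subset that(2)] action_closed coset_join2[of h "\<Gamma> n"] chain_subgroup
    by (auto simp: X1_def cyl_def)
  \<comment> \<open>Inside \<open>X1\<close>, the generators join any two points that an element of \<open>\<Gamma> n\<close> relates.\<close>
  have inner: "(x, boundary_action G x h) \<in> ?P" if "h \<in> generate G D" "x \<in> X1" for x h
    using that
  proof (induction h arbitrary: x)
    case one
    then show ?case using X1 action_one by auto
  next
    case (incl h)
    then show ?case by (intro r_into_rtrancl) (auto simp: S_def R_def)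
  next
    case (inv h)
    have h: "h \<in> \<Gamma> n" "h \<in> carrier G" using D(2) inv chain_subset[of n] by auto
    then have y: "boundary_action G x (inv h) \<in> X1"
      using X1_iff inv subgroup.m_inv_closed[OF chain_subgroup] by blast
    then have "(boundary_action G x (inv h), boundary_action G (boundary_action G x (inv h)) h) \<in> S"
      using inv by (auto simp: S_def R_def)
    then have "(boundary_action G x (inv h), x) \<in> S"
      using action_inv(2)[of x h] h X1 inv by auto
    then show ?case by (intro r_into_rtrancl) auto
  next
    case (eng h k)
    have hk: "h \<in> \<Gamma> n" "h \<in> carrier G" "k \<in> carrier G" using eng(1,2) D(3) chain_subset[of n] by auto
    have "(x, boundary_action G x h) \<in> ?P" using eng by blast
    also have "(boundary_action G x h, boundary_action G (boundary_action G x h) k) \<in> ?P"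
      by (rule eng.IH(2)[OF X1_iff[OF eng.prems hk(1)]])
    also have "boundary_action G (boundary_action G x h) k = boundary_action G x (h \<otimes> k)"
      using action_mult[of x h k] hk X1(2) eng.prems by blast
    finally show ?case .
  qed
  \<comment> \<open>Every point has a point of \<open>X1\<close> in its orbit to which it is joined.\<close>
  have proj: "\<exists>g x'. g \<in> carrier G \<and> x' \<in> X1 \<and> x = boundary_action G x' g \<and> (x', x) \<in> ?P"
    if x: "x \<in> X" for x
  proof (cases "snd (x n) = \<Gamma> n")
    case True
    then have "x \<in> X1" using x by (simp add: X1_def cyl_def)
    then show ?thesis using x action_one by (intro exI[of _ \<one>] exI[of _ x]) simp
  next
    case False
    define C where "C = snd (x n)"
    have C: "C \<in> rcosets \<Gamma> n" "C \<noteq> \<Gamma> n" using x False boundary_snd by (auto simp: C_def)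
    define x' where "x' = boundary_action G x (inv (t C))"
    have "snd (x' n) = \<Gamma> n"
      using t[OF C(1)] translate_eq_iff[OF \<Gamma>_coset C(1), of "t C"] by (simp add: x'_def C_def)
    then have x': "x' \<in> X1" using x t[OF C(1)] action_closed by (auto simp: x'_def X1_def cyl_def)
    have e: "x = boundary_action G x' (t C)" using action_inv(2)[OF x] t[OF C(1)] by (simp add: x'_def)
    have "(x', x) \<in> S" using x' e C by (auto simp: S_def R_def)
    then show ?thesis using t[OF C(1)] x' e by (intro exI[of _ "t C"] exI[of _ x']) auto
  qed
  have spans: "graph_spans S (boundary_orbit_relation G \<Gamma>)"
    unfolding graph_spans_def
  proof (safe)
    fix x y assume "(x, y) \<in> boundary_orbit_relation G \<Gamma>"
    then obtain \<gamma> where x: "x \<in> X" "\<gamma> \<in> carrier G" "y = boundary_action G x \<gamma>" and y: "y \<in> X"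
      by (auto simp: boundary_orbit_relation_def orbit_relation_def)
    obtain g x' where gx: "g \<in> carrier G" "x' \<in> X1" "x = boundary_action G x' g" "(x', x) \<in> ?P"
      using proj[OF x(1)] by blast
    obtain h y' where hy: "h \<in> carrier G" "y' \<in> X1" "y = boundary_action G y' h" "(y', y) \<in> ?P"
      using proj[OF y] by blast
    have X': "x' \<in> X" "y' \<in> X" using gx hy X1 by auto
    \<comment> \<open>The element that carries \<open>x'\<close> to \<open>y'\<close>; it lies in \<open>\<Gamma> n\<close> because both points lie in \<open>X1\<close>.\<close>
    define k where "k = g \<otimes> \<gamma> \<otimes> inv h"
    have k: "k \<in> carrier G" using gx hy x by (simp add: k_def)
    have "y' = boundary_action G y (inv h)" using hy X' action_inv by simp
    also have "\<dots> = boundary_action G x' k"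
      using x gx X' hy(1) by (simp add: action_mult k_def)
    finally have y': "y' = boundary_action G x' k" .
    have "\<Gamma> n #> k = \<Gamma> n" using y' gx(2) hy(2) by (auto simp: X1_def cyl_def)
    then have "k \<in> \<Gamma> n" using coset_join1[OF _ k chain_subgroup] by simp
    then have "(x', y') \<in> ?P" using inner[of k x'] D gx y' by simp
    then show "(x, y) \<in> ?P" using gx hy sym by (meson rtrancl_trans)
  qed
  have deg: "out_degree S x \<le> of_nat (card R) * indicator X1 x" for x
  proof (cases "x \<in> X1")
    case True
    have sub: "{y. (x, y) \<in> S} \<subseteq> (\<lambda>g. boundary_action G x g) ` R" by (auto simp: S_def)
    have "out_degree S x \<le> emeasure (count_space UNIV) ((\<lambda>g. boundary_action G x g) ` R)"
      unfolding out_degree_def using sub by (intro emeasure_mono) auto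
    also have "\<dots> \<le> of_nat (card R)"
      using R card_image_le[OF R(1)] by (simp add: emeasure_count_space)
    finally show ?thesis using True by simp
  next
    case False
    then have "{y. (x, y) \<in> S} = {}" by (auto simp: S_def)
    then show ?thesis by (simp add: out_degree_def)
  qed
  have "cost \<mu> (boundary_orbit_relation G \<Gamma>) \<le> edge_measure \<mu> S"
    unfolding cost_def using bsub spans by (intro INF_lower) simp
  also have "\<dots> \<le> (\<integral>\<^sup>+ x. of_nat (card R) * indicator X1 x \<partial>\<mu>)"
    unfolding edge_measure_def by (intro nn_integral_mono deg)
  also have "\<dots> = of_nat (card R) * emeasure \<mu> X1"
    using X1 by (simp add: nn_integral_cmult_indicator)
  also have "\<dots> = ennreal (real (card R) / real (idx n))"
    using emeasure_shadow[OF \<Gamma>_coset] shadow_cyl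
    by (simp add: X1_def ennreal_of_nat_eq_real_of_nat ennreal_mult[symmetric])
  also have "\<dots> \<le> ennreal ((real (card D) + real (idx n) - 1) / real (idx n))"
    using cR idx_pos[of n] by (intro ennreal_leI divide_right_mono) auto
  finally show ?thesis using D by simp
qed

section \<open>Measurable sets are nearly cylinders\<close>

text \<open>
  The sets that can be approximated in measure form a \<open>\<sigma>\<close>-algebra: for a countable union, truncate it first and
  then approximate its finitely many members. Two one-sided estimates are stated because they are used
  separately: \<open>A - B\<close> controls the paths that are lost when \<open>A\<close> is replaced by \<open>B\<close>, and \<open>B - A\<close> the measure
  that is gained.
\<close>
lemma cylinder_approximation:
  assumes "A \<in> sets \<mu>" "e > 0"
  shows "\<exists>B\<in>cylinders. measure \<mu> (A - B) < e \<and> measure \<mu> (B - A) < e"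
proof -
  interpret finite_measure \<mu> by (rule finite_boundary_measure)
  interpret C: algebra X cylinders by (rule algebra_cylinders)
  have "A \<in> sigma_sets X cylinders" using assms(1) by (simp add: sets_boundary_measure)
  then show ?thesis using assms(2)
  proof (induction arbitrary: e)
    case (Basic A)
    then show ?case by (intro bexI[of _ A]) simp_all
  next
    case Empty
    then show ?case by (intro bexI[of _ "{}"]) simp_all
  next
    case (Compl A)
    obtain B where B: "B \<in> cylinders" "measure \<mu> (A - B) < e" "measure \<mu> (B - A) < e"
      using Compl.IH[OF Compl.prems] by blast
    have "A \<subseteq> X" using sets.sets_into_space[of A \<mu>] Compl.hyps by (simp add: sets_boundary_measure)
    moreover have "B \<subseteq> X" using B C.sets_into_space by blast
    ultimately have "(X - A) - (X - B) = B - A" "(X - B) - (X - A) = A - B" by auto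
    then show ?case using B by (intro bexI[of _ "X - B"]) auto
  next
    case (Union A)
    have A: "A i \<in> sets \<mu>" for i using Union.hyps by (simp add: sets_boundary_measure)
    have UA: "(\<Union>i. A i) \<in> sets \<mu>" using A by blast
    have "(\<lambda>N. measure \<mu> (\<Union>i<N. A i)) \<longlonglongrightarrow> measure \<mu> (\<Union>N. \<Union>i<N. A i)"
      using A by (intro finite_Lim_measure_incseq) (auto simp: incseq_def intro: less_le_trans)
    moreover have "(\<Union>N. \<Union>i<N. A i) = (\<Union>i. A i)" by auto
    ultimately have "\<forall>\<^sub>F N in sequentially. dist (measure \<mu> (\<Union>i<N. A i)) (measure \<mu> (\<Union>i. A i)) < e / 2"
      using Union.prems by (intro tendstoD) auto
    then obtain N where N: "dist (measure \<mu> (\<Union>i<N. A i)) (measure \<mu> (\<Union>i. A i)) < e / 2"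
      by (meson eventually_sequentially order_refl)
    have tail: "measure \<mu> ((\<Union>i. A i) - (\<Union>i<N. A i)) < e / 2"
    proof -
      have "measure \<mu> ((\<Union>i. A i) - (\<Union>i<N. A i)) = measure \<mu> (\<Union>i. A i) - measure \<mu> (\<Union>i<N. A i)"
        using A by (intro finite_measure_Diff) auto
      then show ?thesis using N unfolding dist_real_def by linarith
    qed
    define d where "d = e / (2 * (real N + 1))"
    have d: "d > 0" using Union.prems by (simp add: d_def)
    have "\<forall>i. \<exists>B\<in>cylinders. measure \<mu> (A i - B) < d \<and> measure \<mu> (B - A i) < d"
      using Union.IH d by blast
    then obtain B where B: "\<And>i. B i \<in> cylinders" "\<And>i. measure \<mu> (A i - B i) < d"
      "\<And>i. measure \<mu> (B i - A i) < d" by metis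
    have Bs: "B i \<in> sets \<mu>" for i using B cylinder_sets by blast
    have Nd: "real N * d < e / 2" using Union.prems by (simp add: d_def field_simps)
    have sumle: "measure \<mu> (\<Union>i<N. D i) \<le> real N * d"
      if "\<And>i. D i \<in> sets \<mu>" "\<And>i. measure \<mu> (D i) < d" for D
    proof -
      have "measure \<mu> (\<Union>i<N. D i) \<le> (\<Sum>i<N. measure \<mu> (D i))"
        using that by (intro finite_measure_subadditive_finite) auto
      also have "\<dots> \<le> (\<Sum>i<N. d)" using that by (intro sum_mono less_imp_le)
      finally show ?thesis by simp
    qed
    show ?case
    proof (intro bexI[of _ "\<Union>i<N. B i"] conjI)
      show "(\<Union>i<N. B i) \<in> cylinders" using B by (intro C.finite_UN) auto
      have "measure \<mu> ((\<Union>i. A i) - (\<Union>i<N. B i)) \<le>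
          measure \<mu> (((\<Union>i. A i) - (\<Union>i<N. A i)) \<union> (\<Union>i<N. A i - B i))"
        using A Bs UA by (intro finite_measure_mono) auto
      also have "\<dots> \<le> measure \<mu> ((\<Union>i. A i) - (\<Union>i<N. A i)) + measure \<mu> (\<Union>i<N. A i - B i)"
        using A Bs UA by (intro measure_union_le) auto
      also have "\<dots> < e" using tail sumle[of "\<lambda>i. A i - B i"] A Bs B Nd by auto
      finally show "measure \<mu> ((\<Union>i. A i) - (\<Union>i<N. B i)) < e" .
      have "measure \<mu> ((\<Union>i<N. B i) - (\<Union>i. A i)) \<le> measure \<mu> (\<Union>i<N. B i - A i)"
        using A Bs by (intro finite_measure_mono) auto
      also have "\<dots> < e" using sumle[of "\<lambda>i. B i - A i"] A Bs B Nd Union.prems by auto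
      finally show "measure \<mu> ((\<Union>i<N. B i) - (\<Union>i. A i)) < e" .
    qed
  qed
qed

section \<open>Sets of points that follow a word\<close>

text \<open>
  A graph with labels in the group, given by the set \<open>a g\<close> of starting points of its edges with label \<open>g\<close>.
\<close>
definition labelled_edges :: "('a \<Rightarrow> (nat \<Rightarrow> nat \<times> 'a set) set) \<Rightarrow> ((nat \<Rightarrow> nat \<times> 'a set) \<times> 'a) set" where
  "labelled_edges a = {(x, g). g \<in> carrier G \<and> x \<in> a g}"

definition path_set ::
    "('a \<Rightarrow> (nat \<Rightarrow> nat \<times> 'a set) set) \<Rightarrow> ('a \<times> bool) list \<Rightarrow> (nat \<Rightarrow> nat \<times> 'a set) set" where
  "path_set a w = {x \<in> X. traverses G (boundary_action G) (labelled_edges a) w x}"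

lemma path_set_Nil: "path_set a [] = X"
  by (simp add: path_set_def)

lemma path_set_Cons:
  "g \<in> carrier G \<Longrightarrow> path_set a ((g, True) # w) =
     {x \<in> X. x \<in> a g \<and> boundary_action G x g \<in> path_set a w}"
  "g \<in> carrier G \<Longrightarrow> path_set a ((g, False) # w) =
     {x \<in> X. boundary_action G x (inv g) \<in> a g \<and> boundary_action G x (inv g) \<in> path_set a w}"
  "g \<notin> carrier G \<Longrightarrow> path_set a ((g, b) # w) = {}"
  by (auto simp: path_set_def letter_edge_def letter_value_def labelled_edges_def action_closed)

text \<open>
  Applied to the measurable sets and to the cylinders. Only finitely many set operations and translations
  occur, so a graph made of cylinders has cylinders as its path sets.
\<close>
lemma path_set_in_algebra:
  assumes "algebra X \<A>"
    and tr: "\<And>g A. g \<in> carrier G \<Longrightarrow> A \<in> \<A> \<Longrightarrow> {x \<in> X. boundary_action G x g \<in> A} \<in> \<A>"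
    and a: "\<And>g. a g \<in> \<A>"
  shows "path_set a w \<in> \<A>"
proof -
  interpret algebra X \<A> by fact
  show ?thesis
  proof (induction w)
    case Nil
    then show ?case by (simp add: path_set_Nil)
  next
    case (Cons l w)
    obtain g b where l: "l = (g, b)" by force
    show ?case
    proof (cases "g \<in> carrier G")
      case g: True
      have "path_set a (l # w) = (if b then a g \<inter> {x \<in> X. boundary_action G x g \<in> path_set a w}
          else {x \<in> X. boundary_action G x (inv g) \<in> a g \<inter> path_set a w})"
        using path_set_Cons(1,2)[OF g] by (auto simp: l)
      then show ?thesis using tr[OF g Cons] tr[of "inv g" "a g \<inter> path_set a w"] a[of g] Cons g by auto
    qed (simp add: l path_set_Cons)
  qed
qed

lemma path_set_sets: "(\<And>g. a g \<in> sets \<mu>) \<Longrightarrow> path_set a w \<in> sets \<mu>"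
  by (rule path_set_in_algebra) (use sets.algebra_axioms[of \<mu>] sets_translate in auto)

lemma cylinders_translate:
  assumes g: "g \<in> carrier G" and "A \<in> cylinders"
  shows "{x \<in> X. boundary_action G x g \<in> A} \<in> cylinders"
proof -
  obtain n B where B: "B \<subseteq> rcosets \<Gamma> n" "A = cyl n B" using assms by (auto simp: cylinders_def)
  have "{x \<in> X. boundary_action G x g \<in> A} = cyl n {C \<in> rcosets \<Gamma> n. C #> g \<in> B}"
    using B boundary_snd action_closed[OF _ g] by (auto simp: cyl_def)
  then show ?thesis by (auto simp: cylinders_def)
qed

lemma path_set_cylinders: "(\<And>g. a g \<in> cylinders) \<Longrightarrow> path_set a w \<in> cylinders"
  by (rule path_set_in_algebra) (use algebra_cylinders cylinders_translate in auto)

lemma path_set_mono: "(\<And>g. a g \<subseteq> b g) \<Longrightarrow> path_set a w \<subseteq> path_set b w"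
  unfolding path_set_def labelled_edges_def
  by (auto elim!: traverses_mono)

text \<open>
  A point that follows the word in \<open>a\<close> but not in \<open>b\<close> must at some step use an edge that \<open>b\<close> lacks. For each
  step this is a translate of a set \<open>a g - b g\<close>, and translation preserves the measure.
\<close>
lemma path_set_stable:
  assumes a: "\<And>g. a g \<in> sets \<mu>" and b: "\<And>g. b g \<in> sets \<mu>"
    and close: "\<And>g. g \<in> fst ` set w \<Longrightarrow> measure \<mu> (a g - b g) \<le> d"
  shows "measure \<mu> (path_set a w - path_set b w) \<le> real (length w) * d"
  using close
proof (induction w)
  case Nil
  then show ?case by (simp add: path_set_Nil)
next
  case (Cons l w)
  interpret finite_measure \<mu> by (rule finite_boundary_measure)
  obtain g c where l: "l = (g, c)" by force
  have dg: "measure \<mu> (a g - b g) \<le> d" using Cons.prems by (simp add: l)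
  then have d: "0 \<le> d" using measure_nonneg order_trans by blast
  have IH: "measure \<mu> (path_set a w - path_set b w) \<le> real (length w) * d"
    using Cons by simp
  have P: "path_set a w - path_set b w \<in> sets \<mu>" using path_set_sets a b by blast
  show ?case
  proof (cases "g \<in> carrier G")
    case g: True
    define h where "h = (if c then g else inv g)"
    \<comment> \<open>\<open>E\<close> collects the points that fail at the first letter, \<open>F\<close> those that fail later.\<close>
    define E where "E = (if c then a g - b g else {x \<in> X. boundary_action G x h \<in> a g - b g})"
    define F where "F = {x \<in> X. boundary_action G x h \<in> path_set a w - path_set b w}"
    have h: "h \<in> carrier G" using g by (simp add: h_def)
    have ab: "a g - b g \<in> sets \<mu>" using a b by blast
    have E: "E \<in> sets \<mu>" "measure \<mu> E \<le> d"
      using ab dg sets_translate[OF h ab] measure_translate[OF h ab] by (auto simp: E_def)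
    have F: "F \<in> sets \<mu>" "measure \<mu> F \<le> real (length w) * d"
      using IH sets_translate[OF h P] measure_translate[OF h P] by (auto simp: F_def)
    have "path_set a (l # w) - path_set b (l # w) \<subseteq> E \<union> F"
      using path_set_Cons(1,2)[OF g] by (auto simp: l E_def F_def h_def)
    then have "measure \<mu> (path_set a (l # w) - path_set b (l # w)) \<le> measure \<mu> (E \<union> F)"
      using E F by (intro finite_measure_mono) auto
    also have "\<dots> \<le> measure \<mu> E + measure \<mu> F" using E F by (intro measure_union_le)
    also have "\<dots> \<le> real (length (l # w)) * d" using E F by (simp add: algebra_simps)
    finally show ?thesis .
  qed (use d in \<open>simp add: l path_set_Cons\<close>)
qed

section \<open>Replacing a spanning graph by a graph of cylinders\<close>

definition edges_with_label ::
    "((nat \<Rightarrow> nat \<times> 'a set) \<times> (nat \<Rightarrow> nat \<times> 'a set)) set \<Rightarrow> 'a \<Rightarrow> (nat \<Rightarrow> nat \<times> 'a set) set" where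
  "edges_with_label S g = (if g \<in> carrier G then {x \<in> X. (x, boundary_action G x g) \<in> S} else {})"

lemma edges_with_label_sets:
  assumes "S \<in> sets (\<mu> \<Otimes>\<^sub>M \<mu>)"
  shows "edges_with_label S g \<in> sets \<mu>"
proof (cases "g \<in> carrier G")
  case True
  have "(\<lambda>x. (x, boundary_action G x g)) \<in> measurable \<mu> (\<mu> \<Otimes>\<^sub>M \<mu>)"
    using action_measurable[OF True] by simp
  from measurable_sets[OF this assms] show ?thesis
    using True by (simp add: edges_with_label_def vimage_def Int_def conj_commute)
qed (simp add: edges_with_label_def)

lemma action_inj_of_trivial_stabilizer:
  assumes x: "x \<in> X" and free: "point_stabilizer G (boundary_action G) x = {\<one>}"
    and g: "g \<in> carrier G" "h \<in> carrier G" and eq: "boundary_action G x g = boundary_action G x h"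
  shows "g = h"
proof -
  have "boundary_action G x (g \<otimes> inv h) = boundary_action G (boundary_action G x h) (inv h)"
    using x g by (simp add: action_mult[symmetric] eq)
  also have "\<dots> = x" using x g action_inv by simp
  finally have "g \<otimes> inv h = \<one>" using free g by (auto simp: point_stabilizer_def)
  then show ?thesis using g by (metis inv_closed inv_equality inv_inv)
qed

text \<open>
  Where the stabilizer is trivial, distinct labels lead to distinct neighbours, so the number of labels in
  \<open>F\<close> carried by edges of \<open>S\<close> at \<open>x\<close> is at most the out-degree.
\<close>
lemma sum_labels_le_edge_measure:
  assumes free: "essentially_free G \<mu> (boundary_action G)"
    and S: "S \<in> sets (\<mu> \<Otimes>\<^sub>M \<mu>)" and F: "finite F" "F \<subseteq> carrier G"
  shows "ennreal (\<Sum>g\<in>F. measure \<mu> (edges_with_label S g)) \<le> edge_measure \<mu> S"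
proof -
  interpret finite_measure \<mu> by (rule finite_boundary_measure)
  let ?a = "edges_with_label S"
  have "ennreal (\<Sum>g\<in>F. measure \<mu> (?a g)) = (\<Sum>g\<in>F. emeasure \<mu> (?a g))"
    by (simp add: emeasure_eq_measure sum_ennreal)
  also have "\<dots> = (\<Sum>g\<in>F. \<integral>\<^sup>+ x. indicator (?a g) x \<partial>\<mu>)"
    using edges_with_label_sets[OF S] by simp
  also have "\<dots> = (\<integral>\<^sup>+ x. (\<Sum>g\<in>F. indicator (?a g) x) \<partial>\<mu>)"
    using edges_with_label_sets[OF S] by (intro nn_integral_sum[symmetric]) auto
  also have "\<dots> \<le> (\<integral>\<^sup>+ x. out_degree S x \<partial>\<mu>)"
  proof (rule nn_integral_mono_AE)
    have "AE x in \<mu>. point_stabilizer G (boundary_action G) x = {\<one>}"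
      using free by (simp add: essentially_free_def)
    then show "AE x in \<mu>. (\<Sum>g\<in>F. indicator (?a g) x) \<le> out_degree S x"
    proof (rule AE_mp, intro AE_I2 impI)
      fix x assume x: "x \<in> space \<mu>" and st: "point_stabilizer G (boundary_action G) x = {\<one>}"
      define F' where "F' = {g \<in> F. x \<in> ?a g}"
      have inj: "inj_on (boundary_action G x) F'"
        using action_inj_of_trivial_stabilizer[OF _ st] x F by (intro inj_onI) (auto simp: F'_def)
      have "(\<Sum>g\<in>F. indicator (?a g) x :: ennreal) = of_nat (card F')"
        using F by (simp add: indicator_def F'_def sum.If_cases Int_def conj_commute)
      also have "\<dots> = of_nat (card (boundary_action G x ` F'))" using inj by (simp add: card_image)
      also have "\<dots> = emeasure (count_space UNIV) (boundary_action G x ` F')"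
        using F by (simp add: F'_def emeasure_count_space)
      also have "\<dots> \<le> out_degree S x"
        unfolding out_degree_def
        by (intro emeasure_mono) (auto simp: F'_def edges_with_label_def split: if_splits)
      finally show "(\<Sum>g\<in>F. indicator (?a g) x) \<le> out_degree S x" .
    qed
  qed
  finally show ?thesis by (simp add: edge_measure_def)
qed

lemma path_of_connection:
  assumes S: "S \<subseteq> boundary_orbit_relation G \<Gamma>" and "(x, y) \<in> (S \<union> S\<inverse>)\<^sup>*" "x \<in> X"
  shows "\<exists>w \<in> lists (carrier G \<times> UNIV). x \<in> path_set (edges_with_label S) w \<and>
           y = boundary_action G x (word_value G w)"
  using assms(2,3)
proof (induction rule: converse_rtrancl_induct)
  case base
  then show ?case by (intro bexI[of _ "[]"]) (auto simp: path_set_Nil action_one)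
next
  case (step x z)
  let ?a = "edges_with_label S"
  have E: "u \<in> X \<and> v \<in> X \<and> (\<exists>g\<in>carrier G. v = boundary_action G u g)" if "(u, v) \<in> S" for u v
    using that S by (auto simp: boundary_orbit_relation_def orbit_relation_def)
  have z: "z \<in> X" using step.hyps E by blast
  obtain w where w: "w \<in> lists (carrier G \<times> UNIV)" "z \<in> path_set ?a w"
    "y = boundary_action G z (word_value G w)"
    using step.IH[OF z] by blast
  show ?case
  proof (cases "(x, z) \<in> S")
    case True
    then obtain g where g: "g \<in> carrier G" "z = boundary_action G x g" using E by blast
    have "x \<in> path_set ?a ((g, True) # w)"
      using g w step.prems True by (simp add: path_set_Cons edges_with_label_def)
    moreover have "y = boundary_action G x (word_value G ((g, True) # w))"
      using g w step.prems word_value_closed[OF w(1)] by (simp add: action_mult letter_value_def)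
    ultimately show ?thesis using g w by (intro bexI[of _ "(g, True) # w"]) auto
  next
    case False
    then have "(z, x) \<in> S" using step.hyps by auto
    then obtain g where g: "g \<in> carrier G" "x = boundary_action G z g" using E by blast
    have zx: "z = boundary_action G x (inv g)" using g z action_inv(1) by simp
    have "x \<in> path_set ?a ((g, False) # w)"
      using g w z step.prems \<open>(z, x) \<in> S\<close>
      by (simp add: path_set_Cons edges_with_label_def action_inv(1)[OF z g(1)])
    moreover have "y = boundary_action G x (word_value G ((g, False) # w))"
      using g(1) w step.prems word_value_closed[OF w(1)] zx by (simp add: action_mult letter_value_def)
    ultimately show ?thesis using g w by (intro bexI[of _ "(g, False) # w"]) auto
  qed
qed

text \<open>
  A path in \<open>S\<close> from \<open>x\<close> to \<open>x q\<close> only gives a word with \<open>x w = x q\<close>; that its value is \<open>q\<close> in the group is the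
  point where freeness is indispensable.
\<close>
lemma generic_point_has_path:
  assumes S: "S \<subseteq> boundary_orbit_relation G \<Gamma>" "graph_spans S (boundary_orbit_relation G \<Gamma>)"
    and x: "x \<in> X" "point_stabilizer G (boundary_action G) x = {\<one>}" and q: "q \<in> carrier G"
  shows "\<exists>w \<in> lists (carrier G \<times> UNIV). word_value G w = q \<and> x \<in> path_set (edges_with_label S) w"
proof -
  let ?y = "boundary_action G x q"
  have "(x, ?y) \<in> boundary_orbit_relation G \<Gamma>"
    using x q action_closed by (auto simp: boundary_orbit_relation_def orbit_relation_def)
  then have "(x, ?y) \<in> (S \<union> S\<inverse>)\<^sup>*" using S(2) by (cases "x = ?y") (auto simp: graph_spans_def)
  then obtain w where w: "w \<in> lists (carrier G \<times> UNIV)" "x \<in> path_set (edges_with_label S) w"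
    "?y = boundary_action G x (word_value G w)"
    using path_of_connection[OF S(1) _ x(1)] by blast
  then show ?thesis
    using action_inj_of_trivial_stabilizer[OF x q word_value_closed[OF w(1)]] by auto
qed

text \<open>
  There are countably many words, and together they serve almost every point; continuity of the measure
  leaves finitely many of them.
\<close>
lemma finitely_many_words_almost_cover:
  assumes fg: "finitely_generated G" and free: "essentially_free G \<mu> (boundary_action G)"
    and S: "S \<in> sets (\<mu> \<Otimes>\<^sub>M \<mu>)" "S \<subseteq> boundary_orbit_relation G \<Gamma>"
      "graph_spans S (boundary_orbit_relation G \<Gamma>)"
    and q: "q \<in> carrier G" and e: "e > 0"
  shows "\<exists>W. finite W \<and> W \<subseteq> {w \<in> lists (carrier G \<times> UNIV). word_value G w = q} \<and>
           measure \<mu> (X - (\<Union>w\<in>W. path_set (edges_with_label S) w)) < e"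
proof -
  interpret finite_measure \<mu> by (rule finite_boundary_measure)
  let ?P = "path_set (edges_with_label S)"
  let ?W = "{w \<in> lists (carrier G \<times> (UNIV :: bool set)). word_value G w = q}"
  have P: "?P w \<in> sets \<mu>" for w using edges_with_label_sets[OF S(1)] by (rule path_set_sets)
  have "countable (carrier G \<times> (UNIV :: bool set))"
    using finitely_generated_countable[OF fg] by (intro countable_SIGMA) auto
  then have cW: "countable ?W" by (intro countable_subset[OF _ countable_lists]) auto
  have "[(q, True)] \<in> ?W" using q by (simp add: letter_value_def)
  then have neW: "?W \<noteq> {}" by blast
  define f where "f = from_nat_into ?W"
  have f: "range f = ?W" unfolding f_def using neW cW by (rule range_from_nat_into)
  have "AE x in \<mu>. x \<in> (\<Union>i. ?P (f i))"
  proof -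
    have "AE x in \<mu>. point_stabilizer G (boundary_action G) x = {\<one>}"
      using free by (simp add: essentially_free_def)
    then show ?thesis
    proof (rule AE_mp, intro AE_I2 impI)
      fix x assume "x \<in> space \<mu>" "point_stabilizer G (boundary_action G) x = {\<one>}"
      then obtain w where "w \<in> ?W" "x \<in> ?P w"
        using generic_point_has_path[OF S(2,3) _ _ q, of x] by auto
      then have "w \<in> range f" "x \<in> ?P w" using f by simp_all
      then show "x \<in> (\<Union>i. ?P (f i))" by blast
    qed
  qed
  then have full: "measure \<mu> (\<Union>i. ?P (f i)) = measure \<mu> X"
    using P sets.top[of \<mu>] by (intro measure_eq_AE) auto
  have "(\<lambda>N. measure \<mu> (\<Union>i<N. ?P (f i))) \<longlonglongrightarrow> measure \<mu> (\<Union>N. \<Union>i<N. ?P (f i))"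
    using P by (intro finite_Lim_measure_incseq) (auto simp: incseq_def intro: less_le_trans)
  moreover have "(\<Union>N. \<Union>i<N. ?P (f i)) = (\<Union>i. ?P (f i))" by auto
  ultimately have "(\<lambda>N. measure \<mu> (\<Union>i<N. ?P (f i))) \<longlonglongrightarrow> measure \<mu> X" using full by simp
  then have "\<forall>\<^sub>F N in sequentially. dist (measure \<mu> (\<Union>i<N. ?P (f i))) (measure \<mu> X) < e"
    using e by (intro tendstoD) auto
  then obtain N where N: "dist (measure \<mu> (\<Union>i<N. ?P (f i))) (measure \<mu> X) < e"
    by (meson eventually_sequentially order_refl)
  have "measure \<mu> (X - (\<Union>i<N. ?P (f i))) = measure \<mu> X - measure \<mu> (\<Union>i<N. ?P (f i))"
    using P sets.top[of \<mu>] by (intro finite_measure_Diff) (auto simp: path_set_def)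
  then have "measure \<mu> (X - (\<Union>w\<in>f ` {..<N}. ?P w)) < e"
    using N unfolding dist_real_def image_image by linarith
  then show ?thesis using f by (intro exI[of _ "f ` {..<N}"]) auto
qed

text \<open>
  The error \<open>e\<close> is split in two halves. The points that the chosen words miss already in \<open>S\<close> cost \<open>e1\<close> for each
  generator. Replacing the label sets by cylinders costs \<open>d\<close> for each label in use, and once more for each
  letter of the chosen words, of which there are \<open>L\<close> in total. The words must be fixed before \<open>d\<close> can be
  chosen. The conclusion holds at every point of the boundary, not only at almost every one, so that it
  can be projected to the cosets.
\<close>
lemma cylinder_graph_approximation:
  assumes fg: "finitely_generated G" and free: "essentially_free G \<mu> (boundary_action G)"
    and S: "borel_subgraph \<mu> (boundary_orbit_relation G \<Gamma>) S"
      "graph_spans S (boundary_orbit_relation G \<Gamma>)" "edge_measure \<mu> S \<le> ennreal c" "0 \<le> c"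
    and Q: "finite Q" "Q \<subseteq> carrier G" and e: "e > 0"
  shows "\<exists>b F. finite F \<and> F \<subseteq> carrier G \<and> (\<forall>g. b g \<in> cylinders) \<and> (\<forall>g. g \<notin> F \<longrightarrow> b g = {}) \<and>
           (\<forall>q\<in>Q. \<forall>x\<in>X. \<exists>w. word_value G w = q \<and> x \<in> path_set b w) \<and>
           (\<Sum>g\<in>F. measure \<mu> (b g)) \<le> c + e"
proof -
  interpret finite_measure \<mu> by (rule finite_boundary_measure)
  interpret C: algebra X cylinders by (rule algebra_cylinders)
  have S': "S \<in> sets (\<mu> \<Otimes>\<^sub>M \<mu>)" "S \<subseteq> boundary_orbit_relation G \<Gamma>"
    using S by (auto simp: borel_subgraph_def)
  let ?a = "edges_with_label S"
  have a: "?a g \<in> sets \<mu>" for g using S'(1) by (rule edges_with_label_sets)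
  define e1 where "e1 = e / (2 * (real (card Q) + 1))"
  have e1: "e1 > 0" "real (card Q) * e1 \<le> e / 2" using e by (auto simp: e1_def field_simps)
  have "\<forall>q\<in>Q. \<exists>W. finite W \<and> W \<subseteq> {w \<in> lists (carrier G \<times> UNIV). word_value G w = q} \<and>
           measure \<mu> (X - (\<Union>w\<in>W. path_set ?a w)) < e1"
    using finitely_many_words_almost_cover[OF fg free S' S(2) _ e1(1)] Q by blast
  from bchoice[OF this] obtain W where W': "\<forall>q\<in>Q. finite (W q) \<and>
      W q \<subseteq> {w \<in> lists (carrier G \<times> UNIV). word_value G w = q} \<and>
      measure \<mu> (X - (\<Union>w\<in>W q. path_set ?a w)) < e1" by (elim exE)
  have W: "finite (W q)" "W q \<subseteq> {w \<in> lists (carrier G \<times> UNIV). word_value G w = q}"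
    "measure \<mu> (X - (\<Union>w\<in>W q. path_set ?a w)) < e1" if "q \<in> Q" for q
    using bspec[OF W' that] by simp_all
  define F where "F = (\<Union>q\<in>Q. \<Union>w\<in>W q. fst ` set w)"
  have "fst l \<in> carrier G" if "q \<in> Q" "w \<in> W q" "l \<in> set w" for q w l
  proof -
    have "w \<in> lists (carrier G \<times> UNIV)" using W(2)[OF that(1)] that(2) by blast
    then have "l \<in> carrier G \<times> UNIV" using that(3) by blast
    then show ?thesis by auto
  qed
  then have F: "finite F" "F \<subseteq> carrier G" using Q(1) W(1) by (auto simp: F_def)
  define L where "L = (\<Sum>q\<in>Q. \<Sum>w\<in>W q. real (length w))"
  have L: "L \<ge> 0" unfolding L_def by (intro sum_nonneg) auto
  define d where "d = e / (2 * (real (card F) + L + 1))"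
  have d: "d > 0" "(real (card F) + L) * d \<le> e / 2" using e L by (auto simp: d_def field_simps)
  have "\<forall>g. \<exists>B. B \<in> cylinders \<and> measure \<mu> (?a g - B) < d \<and> measure \<mu> (B - ?a g) < d"
    using cylinder_approximation[OF a d(1)] by (simp add: Bex_def)
  from choice[OF this] obtain b1 where b1: "\<And>g. b1 g \<in> cylinders"
    "\<And>g. measure \<mu> (?a g - b1 g) < d" "\<And>g. measure \<mu> (b1 g - ?a g) < d" by blast
  define b0 where "b0 g = (if g \<in> F then b1 g else {})" for g
  have b0c: "b0 g \<in> cylinders" for g using b1 by (simp add: b0_def)
  have b0s: "b0 g \<in> sets \<mu>" for g using b0c cylinder_sets by blast
  \<comment> \<open>The points not served in the approximating graph. As a cylinder, this set may become part of the
    graph: its points get an edge with label \<open>q\<close>.\<close>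
  define U where "U q = X - (\<Union>w\<in>W q. path_set b0 w)" for q
  have Uc: "U q \<in> cylinders" if "q \<in> Q" for q
    unfolding U_def using W(1)[OF that] path_set_cylinders[OF b0c] by (intro C.Diff C.finite_UN) auto
  have Um: "measure \<mu> (U q) \<le> e1 + (\<Sum>w\<in>W q. real (length w)) * d" if q: "q \<in> Q" for q
  proof -
    have ps: "path_set ?a w \<in> sets \<mu>" "path_set b0 w \<in> sets \<mu>" for w
      using path_set_sets a b0s by blast+
    have Xs: "X \<in> sets \<mu>" using sets.top[of \<mu>] by simp
    \<comment> \<open>A point is missed either by all words in \<open>S\<close> already, or by a word that it follows in \<open>S\<close>.\<close>
    let ?V = "\<Union>w\<in>W q. path_set ?a w" and ?D = "\<Union>w\<in>W q. path_set ?a w - path_set b0 w"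
    have VD: "X - ?V \<in> sets \<mu>" "?D \<in> sets \<mu>"
      using ps Xs W(1)[OF q] by (auto intro!: sets.finite_UN sets.Diff)
    have "measure \<mu> (U q) \<le> measure \<mu> ((X - (\<Union>w\<in>W q. path_set ?a w)) \<union> ?D)"
      unfolding U_def using VD by (intro finite_measure_mono sets.Un) auto
    also have "\<dots> \<le> measure \<mu> (X - (\<Union>w\<in>W q. path_set ?a w)) + measure \<mu> ?D"
      using VD by (rule measure_union_le)
    also have "measure \<mu> ?D \<le> (\<Sum>w\<in>W q. measure \<mu> (path_set ?a w - path_set b0 w))"
      using ps W(1)[OF q] by (intro finite_measure_subadditive_finite) auto
    also have "\<dots> \<le> (\<Sum>w\<in>W q. real (length w) * d)"
    proof (intro sum_mono path_set_stable a b0s)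
      fix w g assume "w \<in> W q" "g \<in> fst ` set w"
      then have "g \<in> F" using q by (auto simp: F_def)
      then show "measure \<mu> (?a g - b0 g) \<le> d" using b1(2)[of g] by (simp add: b0_def)
    qed
    finally show ?thesis using W(3)[OF q] by (simp add: sum_distrib_right)
  qed
  define b where "b g = b0 g \<union> (if g \<in> Q then U g else {})" for g
  have bc: "b g \<in> cylinders" for g using b0c Uc by (auto simp: b_def)
  have cover: "\<exists>w. word_value G w = q \<and> x \<in> path_set b w" if q: "q \<in> Q" and x: "x \<in> X" for q x
  proof (cases "x \<in> U q")
    case True
    then have "x \<in> path_set b [(q, True)]"
      using q Q x action_closed by (auto simp: path_set_Cons path_set_Nil b_def)
    moreover have "word_value G [(q, True)] = q" using q Q by (auto simp: letter_value_def)
    ultimately show ?thesis by blast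
  next
    case False
    then obtain w where w: "w \<in> W q" "x \<in> path_set b0 w" using x by (auto simp: U_def)
    have "path_set b0 w \<subseteq> path_set b w" by (rule path_set_mono) (auto simp: b_def)
    then show ?thesis using w W(2)[OF q] by blast
  qed
  have "(\<Sum>g\<in>F \<union> Q. measure \<mu> (b g)) \<le>
      (\<Sum>g\<in>F \<union> Q. measure \<mu> (b0 g) + (if g \<in> Q then measure \<mu> (U g) else 0))"
  proof (rule sum_mono)
    fix g
    show "measure \<mu> (b g) \<le> measure \<mu> (b0 g) + (if g \<in> Q then measure \<mu> (U g) else 0)"
      using measure_union_le[OF b0s[of g] cylinder_sets[OF Uc, of g]] by (auto simp: b_def)
  qed
  also have "\<dots> = (\<Sum>g\<in>F \<union> Q. measure \<mu> (b0 g)) + (\<Sum>g\<in>F \<union> Q. if g \<in> Q then measure \<mu> (U g) else 0)"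
    by (rule sum.distrib)
  also have "(\<Sum>g\<in>F \<union> Q. measure \<mu> (b0 g)) = (\<Sum>g\<in>F. measure \<mu> (b0 g))"
    using F Q by (intro sum.mono_neutral_right) (auto simp: b0_def)
  also have "(\<Sum>g\<in>F \<union> Q. if g \<in> Q then measure \<mu> (U g) else 0) = (\<Sum>g\<in>Q. measure \<mu> (U g))"
    using F Q by (intro sum.mono_neutral_cong_right) auto
  also have "(\<Sum>g\<in>F. measure \<mu> (b0 g)) \<le> (\<Sum>g\<in>F. measure \<mu> (?a g) + d)"
  proof (rule sum_mono)
    fix g assume g: "g \<in> F"
    have "measure \<mu> (b0 g) \<le> measure \<mu> (?a g \<union> (b0 g - ?a g))"
      using a b0s by (intro finite_measure_mono) auto
    also have "\<dots> \<le> measure \<mu> (?a g) + measure \<mu> (b0 g - ?a g)"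
      using a b0s by (intro measure_union_le) auto
    finally show "measure \<mu> (b0 g) \<le> measure \<mu> (?a g) + d" using b1(3)[of g] g by (simp add: b0_def)
  qed
  also have "\<dots> = (\<Sum>g\<in>F. measure \<mu> (?a g)) + real (card F) * d" by (simp add: sum.distrib)
  also have "(\<Sum>g\<in>F. measure \<mu> (?a g)) \<le> c"
    using sum_labels_le_edge_measure[OF free S'(1) F] S(3,4) by (meson ennreal_le_iff order_trans)
  also have "(\<Sum>g\<in>Q. measure \<mu> (U g)) \<le> (\<Sum>g\<in>Q. e1 + (\<Sum>w\<in>W g. real (length w)) * d)"
    by (intro sum_mono Um)
  also have "\<dots> = real (card Q) * e1 + L * d"
    by (simp add: sum.distrib L_def sum_distrib_right)
  finally have "(\<Sum>g\<in>F \<union> Q. measure \<mu> (b g)) \<le> c + e"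
    using e1(2) d(2) by (simp add: algebra_simps)
  moreover have "\<forall>g. g \<notin> F \<union> Q \<longrightarrow> b g = {}" by (simp add: b_def b0_def)
  ultimately show ?thesis
    using F Q bc cover by (intro exI[of _ b] exI[of _ "F \<union> Q"] conjI) auto
qed

section \<open>Projecting a graph of cylinders to a level\<close>

lemma traverses_level:
  assumes "\<And>g. b g \<noteq> {} \<Longrightarrow> g \<in> F" and "x \<in> path_set b w"
  shows "traverses G (r_coset G) {(C, g). g \<in> F \<and> C \<in> lev n (b g)} w (snd (x n))"
  using assms(2)
proof (induction w arbitrary: x)
  case (Cons l w)
  obtain g c where l: "l = (g, c)" by force
  have g: "g \<in> carrier G" using Cons.prems by (auto simp: l path_set_def letter_edge_def labelled_edges_def)
  have lev: "snd (y n) \<in> lev n (b g) \<and> g \<in> F" if "y \<in> b g" for y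
    using that assms(1) by (auto simp: lev_def)
  show ?case
  proof (cases c)
    case True
    then have "x \<in> b g" "boundary_action G x g \<in> path_set b w"
      using Cons.prems g by (auto simp: l path_set_Cons)
    then show ?thesis
      using Cons.IH[of "boundary_action G x g"] lev[of x] True
      by (simp add: l letter_edge_def letter_value_def)
  next
    case False
    then have "boundary_action G x (inv g) \<in> b g" "boundary_action G x (inv g) \<in> path_set b w"
      using Cons.prems g by (auto simp: l path_set_Cons)
    then show ?thesis
      using Cons.IH[of "boundary_action G x (inv g)"] lev[of "boundary_action G x (inv g)"] False
      by (simp add: l letter_edge_def letter_value_def)
  qed
qed simp

text \<open>
  A cylinder at level \<open>n\<close> has as many cosets as its measure times the index, so the projected graph has
  \<open>idx n\<close> times the total measure as its number of edges. Every coset is the level-\<open>n\<close> vertex of some ray,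
  from which it inherits the paths that spell the generators.
\<close>
lemma rank_bound_at_level:
  assumes Q: "Q \<subseteq> carrier G" "generate G Q = carrier G"
    and F: "finite F" "F \<subseteq> carrier G" and supp: "\<And>g. g \<notin> F \<Longrightarrow> b g = {}"
    and lvl: "\<And>g. g \<in> F \<Longrightarrow> \<exists>B \<subseteq> rcosets \<Gamma> n. b g = cyl n B"
    and cover: "\<And>q x. q \<in> Q \<Longrightarrow> x \<in> X \<Longrightarrow> \<exists>w. word_value G w = q \<and> x \<in> path_set b w"
  shows "(real (min_generators (G\<lparr>carrier := \<Gamma> n\<rparr>)) - 1) / real (idx n) \<le> (\<Sum>g\<in>F. measure \<mu> (b g)) - 1"
proof -
  define A where "A = {(C, g). g \<in> F \<and> C \<in> lev n (b g)}"
  have lev: "lev n (b g) \<subseteq> rcosets \<Gamma> n" "b g = cyl n (lev n (b g))" if "g \<in> F" for g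
    using lvl[OF that] lev_cyl by metis+
  have sub: "A \<subseteq> (rcosets \<Gamma> n) \<times> carrier G" using lev F by (auto simp: A_def)
  have "A \<subseteq> (rcosets \<Gamma> n) \<times> F" using lev by (auto simp: A_def)
  then have fin: "finite A" using chain_finite_index F finite_subset by blast
  have cardA: "real (card A) = real (idx n) * (\<Sum>g\<in>F. measure \<mu> (b g))"
  proof -
    have "A = prod.swap ` (SIGMA g:F. lev n (b g))" by (auto simp: A_def)
    then have "card A = card (SIGMA g:F. lev n (b g))"
      by (simp add: card_image)
    also have "\<dots> = (\<Sum>g\<in>F. card (lev n (b g)))"
      using F(1) finite_subset[OF lev(1) chain_finite_index] by (intro card_SigmaI) auto
    finally have "real (card A) = (\<Sum>g\<in>F. real (card (lev n (b g))))" by simp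
    also have "\<dots> = (\<Sum>g\<in>F. real (idx n) * measure \<mu> (b g))"
    proof (rule sum.cong)
      fix g assume "g \<in> F"
      then show "real (card (lev n (b g))) = real (idx n) * measure \<mu> (b g)"
        using measure_cyl[OF lev(1), of g] lev(2)[of g] idx_pos[of n] by simp
    qed simp
    finally show ?thesis by (simp add: sum_distrib_left)
  qed
  have conn: "\<exists>w. word_value G w = q \<and> traverses G (r_coset G) A w C"
    if "C \<in> rcosets \<Gamma> n" "q \<in> Q" for C q
  proof -
    obtain x where x: "x \<in> X" "C = snd (x n)" using \<open>C \<in> _\<close> level_image[of n] by blast
    then obtain w where "word_value G w = q" "x \<in> path_set b w" using cover \<open>q \<in> Q\<close> by blast
    moreover have "g \<in> F" if "b g \<noteq> {}" for g using that supp by blast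
    ultimately show ?thesis using traverses_level[of b F x w n] x by (auto simp: A_def)
  qed
  have "\<exists>D. finite D \<and> D \<subseteq> \<Gamma> n \<and> generate (G\<lparr>carrier := \<Gamma> n\<rparr>) D = \<Gamma> n \<and>
      card D + card (rcosets \<Gamma> n) \<le> card A + 1"
    by (rule coset_graph_generators[OF chain_subgroup Q chain_finite_index fin sub conn])
  then have "min_generators (G\<lparr>carrier := \<Gamma> n\<rparr>) + idx n \<le> card A + 1"
    using min_generators_le[of _ n] by (fastforce simp: idx_def)
  then have "real (min_generators (G\<lparr>carrier := \<Gamma> n\<rparr>)) - 1 \<le> real (card A) - real (idx n)" by linarith
  also have "\<dots> = real (idx n) * ((\<Sum>g\<in>F. measure \<mu> (b g)) - 1)" by (simp add: cardA algebra_simps)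
  finally show ?thesis using idx_pos[of n] by (simp add: field_simps)
qed

text \<open>
  A cylinder can be described at every level from some level on, and finitely many cylinders have such a
  level in common. The bound therefore holds for all large \<open>n\<close>, which gives convergence of the ratios.
\<close>
lemma eventually_rank_le_edge_measure:
  assumes fg: "finitely_generated G" and free: "essentially_free G \<mu> (boundary_action G)"
    and S: "borel_subgraph \<mu> (boundary_orbit_relation G \<Gamma>) S"
      "graph_spans S (boundary_orbit_relation G \<Gamma>)" "edge_measure \<mu> S \<le> ennreal c" "0 \<le> c"
    and e: "e > 0"
  shows "\<forall>\<^sub>F n in sequentially.
           (real (min_generators (G\<lparr>carrier := \<Gamma> n\<rparr>)) - 1) / real (idx n) \<le> c - 1 + e"
proof -
  obtain Q where Q: "finite Q" "Q \<subseteq> carrier G" "generate G Q = carrier G"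
    using fg by (auto simp: finitely_generated_def)
  obtain b F where F: "finite F" "F \<subseteq> carrier G" and b: "\<forall>g. b g \<in> cylinders"
    and supp: "\<forall>g. g \<notin> F \<longrightarrow> b g = {}"
    and cover: "\<forall>q\<in>Q. \<forall>x\<in>X. \<exists>w. word_value G w = q \<and> x \<in> path_set b w"
    and le: "(\<Sum>g\<in>F. measure \<mu> (b g)) \<le> c + e"
    using cylinder_graph_approximation[OF fg free S Q(1,2) e] by (elim exE conjE)
  have "\<forall>g\<in>F. \<forall>\<^sub>F n in sequentially. \<exists>B \<subseteq> rcosets \<Gamma> n. b g = cyl n B"
    using cylinders_common b by (auto simp: eventually_sequentially)
  then have "\<forall>\<^sub>F n in sequentially. \<forall>g\<in>F. \<exists>B \<subseteq> rcosets \<Gamma> n. b g = cyl n B"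
    using F by (simp add: eventually_ball_finite)
  then show ?thesis
  proof (rule eventually_mono)
    fix n assume "\<forall>g\<in>F. \<exists>B \<subseteq> rcosets \<Gamma> n. b g = cyl n B"
    then have "(real (min_generators (G\<lparr>carrier := \<Gamma> n\<rparr>)) - 1) / real (idx n) \<le>
        (\<Sum>g\<in>F. measure \<mu> (b g)) - 1"
      using rank_bound_at_level[OF Q(2,3) F] supp cover by blast
    then show "(real (min_generators (G\<lparr>carrier := \<Gamma> n\<rparr>)) - 1) / real (idx n) \<le> c - 1 + e"
      using le by simp
  qed
qed

section \<open>Rank gradient and cost\<close>

lemma rank_gradient_eq_cost:
  assumes fg: "finitely_generated G" and free: "essentially_free G \<mu> (boundary_action G)"
  shows "ereal (rank_gradient G \<Gamma>) = enn2ereal (cost \<mu> (boundary_orbit_relation G \<Gamma>)) - 1"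
proof -
  let ?c = "cost \<mu> (boundary_orbit_relation G \<Gamma>)"
  let ?r = "\<lambda>n. (real (min_generators (G\<lparr>carrier := \<Gamma> n\<rparr>)) - 1) / real (idx n)"
  have "?c < \<infinity>" using cost_upper_bound[OF fg, of 0] by (rule le_less_trans) simp
  then obtain c where c: "?c = ennreal c" "c \<ge> 0" by (cases ?c) auto
  have lower: "c - 1 \<le> ?r n" for n
  proof -
    have nn: "0 \<le> (real (min_generators (G\<lparr>carrier := \<Gamma> n\<rparr>)) + real (idx n) - 1) / real (idx n)"
      using idx_pos[of n] by (intro divide_nonneg_nonneg) auto
    have "c \<le> (real (min_generators (G\<lparr>carrier := \<Gamma> n\<rparr>)) + real (idx n) - 1) / real (idx n)"
      using cost_upper_bound[OF fg, of n] c nn by simp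
    then show ?thesis using idx_pos[of n] by (simp add: field_simps)
  qed
  have "?r \<longlonglongrightarrow> c - 1"
  proof (rule order_tendstoI)
    fix y assume "y < c - 1"
    then show "\<forall>\<^sub>F n in sequentially. y < ?r n" using lower less_le_trans by (intro always_eventually) blast
  next
    fix y assume y: "c - 1 < y"
    \<comment> \<open>One \<open>e\<close> is spent on choosing a graph close to the infimum, one on making it a graph of cylinders.\<close>
    define e where "e = (y - (c - 1)) / 3"
    have e: "e > 0" using y by (simp add: e_def)
    have "?c < ennreal (c + e)" using c e by (simp add: ennreal_lessI)
    then obtain S where S: "borel_subgraph \<mu> (boundary_orbit_relation G \<Gamma>) S"
      "graph_spans S (boundary_orbit_relation G \<Gamma>)" "edge_measure \<mu> S < ennreal (c + e)"
      by (auto simp: cost_def INF_less_iff)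
    have "\<forall>\<^sub>F n in sequentially. ?r n \<le> c + e - 1 + e"
      using eventually_rank_le_edge_measure[OF fg free S(1,2) less_imp_le[OF S(3)] _ e] c e by simp
    moreover have "3 * e = y - (c - 1)" by (simp add: e_def)
    then have "c + e - 1 + e < y" using e by linarith
    ultimately show "\<forall>\<^sub>F n in sequentially. ?r n < y" by (auto elim: eventually_mono)
  qed
  then have "rank_gradient G \<Gamma> = c - 1"
    unfolding rank_gradient_def by (simp add: limI idx_def subgroup_index_def)
  then show ?thesis using c by (simp add: enn2ereal_ennreal one_ereal_def)
qed

end

theorem theorem1:
  fixes G :: "('a, 'b) monoid_scheme" and \<Gamma> :: "nat \<Rightarrow> 'a set"
  assumes "group G"
    and "finitely_generated G"
    and "farber_chain G \<Gamma>"
  shows "ereal (rank_gradient G \<Gamma>) =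
    enn2ereal (cost (boundary_measure G \<Gamma>) (boundary_orbit_relation G \<Gamma>)) - 1"
proof -
  have "finite_index_chain G \<Gamma>" "essentially_free G (boundary_measure G \<Gamma>) (boundary_action G)"
    using assms(3) by (auto simp: farber_chain_def)
  then show ?thesis using finite_index_chain.rank_gradient_eq_cost assms(2) by blast
qed

end
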